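(* Consider the fully discrete nonuniform L2-$1_\sigma$ scheme (defined in the context) for the time-fractional Allen–Cahn model with fractional order $\alpha\in(0,1)$, interface parameter $\epsilon>0$ and spatial mesh size $h$. Assume the step ratios satisfy $r_k\ge r_\star(\alpha)$ for all $k\ge2$, where $r_\star(\alpha)$ is the unique positive root $r$ of $$2\sqrt{\frac{2(1-\alpha/2)r}{1+\alpha+(1-\alpha/2)r}+\frac{r}{1+r}}+3-\frac{1}{r^2(1+r)}=0,$$ and the step sizes satisfy, for all $1\le n\le N$, $$\tau_n\le\min\Big\{\Big(\frac{\theta\,\omega_{2-\alpha}(1-\theta)}{2(1-\theta)}\Big)^{1/\alpha},\ \Big(\frac{h^2\,\omega_{2-\alpha}(1-\theta)}{4\epsilon^2}\Big)^{1/\alpha}\Big\},\qquad \theta=\alpha/2.$$ Then the scheme is uniquely solvable, and it preserves the maximum bound principle: if $\|\phi^0\|_\infty\le1$ then $\|\phi^n\|_\infty\le1$ for $1\le n\le N$.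
   Context: Time mesh $0=t_0<\cdots<t_N=T$, $\tau_k=t_k-t_{k-1}$, $r_k=\tau_k/\tau_{k-1}$; $\omega_\beta(t)=t^{\beta-1}/\Gamma(\beta)$; $\theta=\alpha/2$; $t_{n-\theta}=\theta t_{n-1}+(1-\theta)t_n$; $\varpi_n'(t)=\omega_{1-\alpha}(t_{n-\theta}-t)$; $\nabla_\tau v^k=v^k-v^{k-1}$. For $1\le k\le n$: $a^{(n)}_{n-k}=\frac{1}{\tau_k}\int_{t_{k-1}}^{\min\{t_k,t_{n-\theta}\}}\varpi_n'(s)ds$, $\zeta^{(n)}_{n-k}=\frac{2}{\tau_k^2}\int_{t_{k-1}}^{t_k}(s-\frac{t_{k-1}+t_k}{2})\varpi_n'(s)ds$. L2-$1_\sigma$ formula: $(\partial^\alpha_\tau v)^{n-\theta}=a^{(n)}_0\nabla_\tau v^n+\sum_{k=1}^{n-1}\big(a^{(n)}_{n-k}\nabla_\tau v^k+\frac{\nabla_\tau v^{k+1}-r_{k+1}\nabla_\tau v^k}{r_{k+1}(1+r_{k+1})}\zeta^{(n)}_{n-k}\big)$, applied pointwise in space. Space: $\Omega=(0,L)^2$, $h=L/M$, grid $\{(ih,jh):0\le i,j\le M\}$, $\Delta_h$ the standard second-order (five-point) difference Laplacian with periodic boundary conditions, $\|v\|_\infty=\max$ over grid points of $|v|$. With $f(\phi)=\phi^3-\phi$, the scheme is: given $\phi^0$, find grid functions $\phi^n$, $n\ge1$, with $$(\partial^\alpha_\tau\phi)^{n-\theta}=-\mu^{n-\theta},\quad \mu^{n-\theta}=\theta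 f(\phi^{n-1})+(1-\theta)f(\phi^n)-\epsilon^2\Delta_h\big(\theta\phi^{n-1}+(1-\theta)\phi^n\big).$$ *)

theory Defs
  imports "HOL-Analysis.Analysis"
begin

definition omega :: "real \<Rightarrow> real \<Rightarrow> real" where
  "omega \<beta> x = x powr (\<beta> - 1) / Gamma \<beta>"

definition tau :: "(nat \<Rightarrow> real) \<Rightarrow> nat \<Rightarrow> real" where
  "tau t k = t k - t (k - 1)"

definition ratio :: "(nat \<Rightarrow> real) \<Rightarrow> nat \<Rightarrow> real" where
  "ratio t k = tau t k / tau t (k - 1)"

definition tsig :: "real \<Rightarrow> (nat \<Rightarrow> real) \<Rightarrow> nat \<Rightarrow> real" where
  "tsig \<alpha> t n = (\<alpha>/2) * t (n - 1) + (1 - \<alpha>/2) * t n"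

text \<open>aL2 alpha t n k is the coefficient a^{(n)}_{n-k} (1 <= k <= n).\<close>
definition aL2 :: "real \<Rightarrow> (nat \<Rightarrow> real) \<Rightarrow> nat \<Rightarrow> nat \<Rightarrow> real" where
  "aL2 \<alpha> t n k = (1 / tau t k) *
     integral {t (k - 1) .. min (t k) (tsig \<alpha> t n)} (\<lambda>s. omega (1 - \<alpha>) (tsig \<alpha> t n - s))"

text \<open>zetaL2 alpha t n k is the coefficient zeta^{(n)}_{n-k} (1 <= k <= n).\<close>
definition zetaL2 :: "real \<Rightarrow> (nat \<Rightarrow> real) \<Rightarrow> nat \<Rightarrow> nat \<Rightarrow> real" where
  "zetaL2 \<alpha> t n k = (2 / (tau t k)^2) *
     integral {t (k - 1) .. t k}
       (\<lambda>s. (s - (t (k - 1) + t k) / 2) * omega (1 - \<alpha>) (tsig \<alpha> t n - s))"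

definition L2sig :: "real \<Rightarrow> (nat \<Rightarrow> real) \<Rightarrow> nat \<Rightarrow> (nat \<Rightarrow> real) \<Rightarrow> real" where
  "L2sig \<alpha> t n v =
     aL2 \<alpha> t n n * (v n - v (n - 1)) +
     (\<Sum>k = 1..n - 1.
        aL2 \<alpha> t n k * (v k - v (k - 1)) +
        ((v (k + 1) - v k) - ratio t (k + 1) * (v k - v (k - 1)))
          / (ratio t (k + 1) * (1 + ratio t (k + 1))) * zetaL2 \<alpha> t n k)"

text \<open>Periodic grid: the indices 0..M-1 in each direction (index M is identified with 0).\<close>
definition grid :: "nat \<Rightarrow> (nat \<times> nat) set" where
  "grid M = {0..<M} \<times> {0..<M}"

definition lap :: "nat \<Rightarrow> real \<Rightarrow> (nat \<times> nat \<Rightarrow> real) \<Rightarrow> nat \<times> nat \<Rightarrow> real" where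
  "lap M h v p = (case p of (i, j) \<Rightarrow>
     (v ((i + 1) mod M, j) + v ((i + M - 1) mod M, j)
      + v (i, (j + 1) mod M) + v (i, (j + M - 1) mod M) - 4 * v (i, j)) / h^2)"

definition maxnorm :: "nat \<Rightarrow> (nat \<times> nat \<Rightarrow> real) \<Rightarrow> real" where
  "maxnorm M v = Max ((\<lambda>p. \<bar>v p\<bar>) ` grid M)"

definition fAC :: "real \<Rightarrow> real" where
  "fAC x = x^3 - x"

definition scheme_sol ::
  "real \<Rightarrow> real \<Rightarrow> real \<Rightarrow> nat \<Rightarrow> (nat \<Rightarrow> real) \<Rightarrow> nat
     \<Rightarrow> (nat \<times> nat \<Rightarrow> real) \<Rightarrow> (nat \<Rightarrow> nat \<times> nat \<Rightarrow> real) \<Rightarrow> bool" where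
  "scheme_sol \<alpha> \<epsilon> h M t N phi0 Phi \<longleftrightarrow>
     (\<forall>p \<in> grid M. Phi 0 p = phi0 p) \<and>
     (\<forall>n \<in> {1..N}. \<forall>p \<in> grid M.
        L2sig \<alpha> t n (\<lambda>k. Phi k p) =
          - ((\<alpha>/2) * fAC (Phi (n - 1) p) + (1 - \<alpha>/2) * fAC (Phi n p)
             - \<epsilon>^2 * lap M h (\<lambda>q. (\<alpha>/2) * Phi (n - 1) q + (1 - \<alpha>/2) * Phi n q) p))"

definition rfun :: "real \<Rightarrow> real \<Rightarrow> real" where
  "rfun \<alpha> r = 2 * sqrt (2 * (1 - \<alpha>/2) * r / (1 + \<alpha> + (1 - \<alpha>/2) * r) + r / (1 + r))
               + 3 - 1 / (r^2 * (1 + r))"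

definition r_star :: "real \<Rightarrow> real" where
  "r_star \<alpha> = (THE r. r > 0 \<and> rfun \<alpha> r = 0)"

end

theory Submission
  imports Defs
begin

text \<open>
  Write the scheme at step $n$ as
  $A_0 \phi^n + (1-\theta) f(\phi^n) - (1-\theta)\epsilon^2\Delta_h\phi^n = g$. The left-hand side obeys a
  comparison principle, which gives uniqueness, a monotone iteration gives existence, and the constants
  $\pm 1$ are barriers as soon as $|g| \le A_0$. With $u^k = 1 - \phi^k \ge 0$ the latter means that
  $\sum_k D_k u^k - \theta\rho(u^{n-1}) + \theta\epsilon^2\Delta_h u^{n-1} \ge 0$ where
  $D_k = A_{n-k-1} - A_{n-k}$ and $\rho(u) = 2u - 3u^2 + u^3$. The hypothesis on the step ratios yields
  $D_k \ge 0$ for $k \le n-2$, and if also $D_{n-1} \ge \frac{\theta}{1-\theta} a_0$ the step size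
  conditions conclude.

  That last inequality can fail when $r_{n-1} < 0.4753$ and $r_n$ is large. The deficit is then so small that
  it can be charged to a multiple $\gamma$ of the equation of step $n-1$: the old weights of step $n$
  dominate $\gamma$ times those of step $n-1$, and $u^{n-1}$ dominates a fixed fraction of $u^{n-2}$ at every
  grid point. Of the root $r_\star(\alpha)$ only the bound $r_\star(\alpha) \ge 0.386$ is used.
\<close>

section \<open>Moments of the kernel\<close>

text \<open>Integrating by parts makes the kernel values at the nodes cancel in
  \<open>D n k\<close>, and a single negative term \<open>bwd n k\<close> remains. In units of one
  sixth of tau_k times the kernel derivative at t_{k-1} it is at most 1/(r_k^2 (1 + r_k)) <= 4.85,
  while interval k itself supplies 3. For k <= n - 2 the terms in r_{k+1} lift this 3 to at least 3
  + 2 sqrt 2. For k = n - 1 only 1/r_n is added, which is negligible for large r_n; 0.4753 is the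
  root of r^2 (1 + r) = 1/3. The threshold \<theta>/(1 - \<theta>) a_0 has two origins: it bounds
  what the explicit reaction and diffusion terms can cost under the step size conditions, and
  subtracting it from a_0 leaves exactly the kernel value at t_{n-1}. Charging the deficit to step n
  - 1 brings in neighbour sums of u^{n-1} and of u^{n-2}, whereas step n offers only one of u^{n-1}.
  This forces a pointwise domination of u^{n-2} by u^{n-1}. It is available because a small r_{n-1}
  means a long interval before t_{n-2}, which leaves a surplus in the weight of u^{n-2} in step n -
  1.\<close>

definition momP :: "(real \<Rightarrow> real) \<Rightarrow> real \<Rightarrow> real \<Rightarrow> real" where
  "momP J a b = integral {a..b} (\<lambda>s. J s * ((s - a) / (b - a)))"

definition momM :: "(real \<Rightarrow> real) \<Rightarrow> real \<Rightarrow> real \<Rightarrow> real" where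
  "momM J a b = integral {a..b} (\<lambda>s. J s * ((b - s) / (b - a)))"

text \<open>The weights of \<open>momP\<close> and \<open>momM\<close> are the hat functions of the
  interval, the weight here is their product. Up to sign they are antiderivatives of 1/(b - a) and
  of 2 (s - (a + b)/2)/(b - a)^2, the densities in \<open>aL2\<close> and
  \<open>zetaL2\<close>.\<close>

definition momZ :: "(real \<Rightarrow> real) \<Rightarrow> real \<Rightarrow> real \<Rightarrow> real" where
  "momZ J a b = integral {a..b} (\<lambda>s. J s * ((s - a) / (b - a) * ((b - s) / (b - a))))"

lemma mom_integrable:
  fixes a b :: real
  assumes "a < b" "continuous_on {a..b} J"
  shows "(\<lambda>s. J s * ((s - a) / (b - a))) integrable_on {a..b}"
    and "(\<lambda>s. J s * ((b - s) / (b - a))) integrable_on {a..b}"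
    and "(\<lambda>s. J s * ((s - a) / (b - a) * ((b - s) / (b - a)))) integrable_on {a..b}"
  using assms by (auto intro!: integrable_continuous_interval continuous_intros)

text \<open>Reduces moment inequalities to the sign of one weight; the coefficients may be negative,
  as in \<open>momM\<close> minus a multiple of \<open>momZ\<close>.\<close>

lemma mom_combination_nonneg:
  fixes a b :: real
  assumes ab: "a < b" and J: "continuous_on {a..b} J"
    and nonneg: "\<And>s. s \<in> {a..b} \<Longrightarrow>
      0 \<le> J s * (p * ((s - a) / (b - a)) + m * ((b - s) / (b - a))
        + z * ((s - a) / (b - a) * ((b - s) / (b - a))))"
  shows "0 \<le> p * momP J a b + m * momM J a b + z * momZ J a b"
proof -
  note i = mom_integrable[OF ab J]
  have "((\<lambda>s. p * (J s * ((s - a) / (b - a))) + m * (J s * ((b - s) / (b - a)))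
      + z * (J s * ((s - a) / (b - a) * ((b - s) / (b - a))))) has_integral
      p * momP J a b + m * momM J a b + z * momZ J a b) {a..b}"
    unfolding momP_def momM_def momZ_def
    by (intro has_integral_add has_integral_mult_right integrable_integral i)
  then show ?thesis
    by (rule has_integral_nonneg) (use nonneg in \<open>simp add: algebra_simps\<close>)
qed

lemma mom_diff:
  fixes a b c :: real
  assumes ab: "a < b" and J: "continuous_on {a..b} J" and J': "continuous_on {a..b} J'"
  shows "momP (\<lambda>s. J s - c * J' s) a b = momP J a b - c * momP J' a b"
    and "momM (\<lambda>s. J s - c * J' s) a b = momM J a b - c * momM J' a b"
    and "momZ (\<lambda>s. J s - c * J' s) a b = momZ J a b - c * momZ J' a b"
  unfolding momP_def momM_def momZ_def
  by (rule integral_unique, simp only: left_diff_distrib mult.assoc,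
      intro has_integral_diff has_integral_mult_right integrable_integral
        mom_integrable[OF ab J] mom_integrable[OF ab J'])+

lemma mom_affine:
  fixes a b u v :: real
  assumes ab: "a < b"
  shows "momP (\<lambda>s. u + v * (s - a)) a b = (b - a) * (u / 2 + v * (b - a) / 3)"
    and "momM (\<lambda>s. u) a b = (b - a) * u / 2"
    and "momZ (\<lambda>s. u + v * (s - a)) a b = (b - a) * (u / 6 + v * (b - a) / 12)"
proof -
  have d: "b - a \<noteq> 0" using ab by simp
  have "((\<lambda>s. (u + v * (s - a)) * ((s - a) / (b - a))) has_integral
      ((\<lambda>s. (u * (s-a)^2/2 + v * (s-a)^3/3) / (b-a)) b - (\<lambda>s. (u * (s-a)^2/2 + v * (s-a)^3/3) / (b-a)) a)) {a..b}"
    using ab d by (intro fundamental_theorem_of_calculus)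
      (auto intro!: derivative_eq_intros simp: has_real_derivative_iff_has_vector_derivative[symmetric]
         divide_simps power2_eq_square algebra_simps)
  note eqP = integral_unique[OF this]
  show "momP (\<lambda>s. u + v * (s - a)) a b = (b - a) * (u / 2 + v * (b - a) / 3)"
    unfolding momP_def eqP using d by (simp add: field_simps power2_eq_square power3_eq_cube)
  have "((\<lambda>s. u * ((b - s) / (b - a))) has_integral
      ((\<lambda>s. u / (b - a) * (b * s - s^2 / 2)) b - (\<lambda>s. u / (b - a) * (b * s - s^2 / 2)) a)) {a..b}"
    using ab d by (intro fundamental_theorem_of_calculus)
      (auto intro!: derivative_eq_intros simp: has_real_derivative_iff_has_vector_derivative[symmetric])
  note eqM = integral_unique[OF this]
  show "momM (\<lambda>s. u) a b = (b - a) * u / 2"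
  proof -
    have "u / (b - a) * (b * b - b\<^sup>2 / 2) - u / (b - a) * (b * a - a\<^sup>2 / 2)
       = u / (b - a) * ((b - a) * (b - a) / 2)"
      unfolding right_diff_distrib[symmetric] by (simp add: field_simps power2_eq_square)
    then show ?thesis unfolding momM_def eqM using d by simp
  qed
  let ?F = "\<lambda>s. (u * (s-a)^2/2 + v * (s-a)^3/3) / (b-a) - (u * (s-a)^3/3 + v * (s-a)^4/4) / (b-a)^2"
  have "((\<lambda>s. (u + v * (s - a)) * ((s - a) / (b - a) * ((b - s) / (b - a)))) has_integral
      (?F b - ?F a)) {a..b}"
  proof (intro fundamental_theorem_of_calculus)
    fix x
    have eq: "(u + v * (x - a)) * ((x - a) / (b - a) * ((b - x) / (b - a)))
       = (u * (x-a) + v * (x-a)^2) / (b-a) - (u * (x-a)^2 + v * (x-a)^3) / (b-a)^2"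
      using d by (simp add: divide_simps) (simp add: algebra_simps power2_eq_square power3_eq_cube)
    show "(?F has_vector_derivative (u + v * (x - a)) * ((x - a) / (b - a) * ((b - x) / (b - a)))) (at x within {a..b})"
      unfolding eq has_real_derivative_iff_has_vector_derivative[symmetric]
      by (intro DERIV_diff DERIV_cdivide)
        (auto intro!: derivative_eq_intros simp: field_simps power2_eq_square power3_eq_cube)
  qed (use ab in auto)
  note eqZ = integral_unique[OF this]
  show "momZ (\<lambda>s. u + v * (s - a)) a b = (b - a) * (u / 6 + v * (b - a) / 12)"
  proof -
    have "(u * D\<^sup>2 / 2 + v * D ^ 3 / 3) / D - (u * D ^ 3 / 3 + v * D ^ 4 / 4) / D\<^sup>2 = D * (u / 6 + v * D / 12)"
      if "D \<noteq> 0" for D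
      using that by (simp add: field_simps power2_eq_square power3_eq_cube power4_eq_xxxx)
    from this[OF d] show ?thesis unfolding momZ_def eqZ by simp
  qed
qed

text \<open>Nonnegative weights are integrated against \<open>J\<close> minus the constant
  \<open>l\<close>. In the third bound the weight factors as (1 - y (s - a)/(b - a)) (b - s)/(b -
  a), hence y <= 1; in the applications y = 1/(1 + r) with a step ratio r.\<close>

lemma mom_bounds:
  fixes a b :: real
  assumes ab: "a < b" and J: "continuous_on {a..b} J"
    and lo: "\<And>s. s \<in> {a..b} \<Longrightarrow> l \<le> J s"
  shows "(b - a) * l / 2 \<le> momP J a b"
    and "(b - a) * l / 6 \<le> momZ J a b"
    and "0 \<le> y \<Longrightarrow> y \<le> 1 \<Longrightarrow> (b - a) * l * (1 / 2 - y / 6) \<le> momM J a b - y * momZ J a b"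
proof -
  have c: "continuous_on {a..b} (\<lambda>s. l)" by (intro continuous_intros)
  note d = mom_diff[OF ab J c, of 1, simplified]
  have f: "momP (\<lambda>s. l) a b = (b - a) * l / 2" "momZ (\<lambda>s. l) a b = (b - a) * l / 6"
    "momM (\<lambda>s. l) a b = (b - a) * l / 2"
    using mom_affine(1,3)[OF ab, of l 0] mom_affine(2)[OF ab, of l] by simp_all
  have J': "continuous_on {a..b} (\<lambda>s. J s - l)"
    using J by (intro continuous_intros)
  have g: "0 \<le> J s - l" if "s \<in> {a..b}" for s using lo[OF that] by simp
  have x: "0 \<le> (s - a) / (b - a)" "0 \<le> (b - s) / (b - a)" "(s - a) / (b - a) \<le> 1" if "s \<in> {a..b}" for s
    using that ab by (auto simp: divide_simps)
  have "0 \<le> 1 * momP (\<lambda>s. J s - l) a b + 0 * momM (\<lambda>s. J s - l) a b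
    + 0 * momZ (\<lambda>s. J s - l) a b"
    by (rule mom_combination_nonneg[OF ab J']) (use g x in \<open>auto intro!: mult_nonneg_nonneg\<close>)
  then show "(b - a) * l / 2 \<le> momP J a b" unfolding d f by simp
  have "0 \<le> 0 * momP (\<lambda>s. J s - l) a b + 0 * momM (\<lambda>s. J s - l) a b
    + 1 * momZ (\<lambda>s. J s - l) a b"
    by (rule mom_combination_nonneg[OF ab J']) (use g x in \<open>auto intro!: mult_nonneg_nonneg\<close>)
  then show "(b - a) * l / 6 \<le> momZ J a b" unfolding d f by simp
  assume y: "0 \<le> y" "y \<le> 1"
  have "0 \<le> 0 * momP (\<lambda>s. J s - l) a b + 1 * momM (\<lambda>s. J s - l) a b
    + (-y) * momZ (\<lambda>s. J s - l) a b"
  proof (rule mom_combination_nonneg[OF ab J'])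
    have aux: "(1 - y * X) * Y = 0 * X + 1 * Y + - y * (X * Y)" for X Y :: real
      by (simp add: algebra_simps)
    fix s assume s: "s \<in> {a..b}"
    have "y * ((s - a) / (b - a)) \<le> 1 * 1" using y x[OF s] by (intro mult_mono) auto
    then have "0 \<le> (J s - l) * ((1 - y * ((s - a) / (b - a))) * ((b - s) / (b - a)))"
      using g[OF s] x[OF s] by (intro mult_nonneg_nonneg) auto
    also have "\<dots> = (J s - l) * (0 * ((s - a) / (b - a)) + 1 * ((b - s) / (b - a))
       + - y * ((s - a) / (b - a) * ((b - s) / (b - a))))" by (simp only: aux)
    finally show "0 \<le> \<dots>" .
  qed
  then show "(b - a) * l * (1 / 2 - y / 6) \<le> momM J a b - y * momZ J a b"
    unfolding d f by (simp add: field_simps)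
qed

lemma momZ_upper:
  fixes a b :: real
  assumes ab: "a < b" and J: "continuous_on {a..b} J"
    and up: "\<And>s. s \<in> {a..b} \<Longrightarrow> J s \<le> l"
  shows "momZ J a b \<le> (b - a) * l / 6"
proof -
  have "continuous_on {a..b} (\<lambda>s. - J s)" using J by (intro continuous_intros)
  from mom_bounds(2)[OF ab this, of "- l"] up
  have "(b - a) * (- l) / 6 \<le> momZ (\<lambda>s. - J s) a b" by auto
  then show ?thesis by (simp add: momZ_def)
qed

lemma mom_scale:
  fixes a b g :: real
  assumes ab: "a < b" and J: "continuous_on {a..b} J" and J': "continuous_on {a..b} J'"
    and le: "\<And>s. s \<in> {a..b} \<Longrightarrow> g * J' s \<le> J s"
  shows "g * momP J' a b \<le> momP J a b"
    and "g * momZ J' a b \<le> momZ J a b"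
    and "0 \<le> y \<Longrightarrow> y \<le> 1 \<Longrightarrow> g * (momM J' a b - y * momZ J' a b) \<le> momM J a b - y * momZ J a b"
proof -
  have c: "continuous_on {a..b} (\<lambda>s. J s - g * J' s)" using J J' by (intro continuous_intros)
  have "0 \<le> J s - g * J' s" if "s \<in> {a..b}" for s using le[OF that] by simp
  note * = mom_bounds[OF ab c this] and d = mom_diff[OF ab J J', of g]
  show "g * momP J' a b \<le> momP J a b" "g * momZ J' a b \<le> momZ J a b" using * d by simp_all
  assume "0 \<le> y" "y \<le> 1"
  then show "g * (momM J' a b - y * momZ J' a b) \<le> momM J a b - y * momZ J a b"
    using *(3)[of y] d by (simp add: algebra_simps)
qed

text \<open>The weight of \<open>momP\<close> leans to the right and turns the slope v into a gain v
  (b - a)^2/12; the weight of \<open>momZ\<close> is symmetric about the midpoint, so there the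
  slope drops out.\<close>

lemma mom_tangent:
  fixes a b :: real
  assumes ab: "a < b" and J: "continuous_on {a..b} J" and z: "0 \<le> z"
    and tan: "\<And>s. s \<in> {a..b} \<Longrightarrow> j + v * (s - (a + b) / 2) \<le> J s"
  shows "(b - a) * (j * (1 / 2 + z / 6) + v * (b - a) / 12) \<le> momP J a b + z * momZ J a b"
proof -
  let ?A = "\<lambda>s. (j - v * (b - a) / 2) + v * (s - a)"
  have c: "continuous_on {a..b} ?A" by (intro continuous_intros)
  have le: "1 * ?A s \<le> J s" if "s \<in> {a..b}" for s using tan[OF that] by (simp add: field_simps)
  note s = mom_scale[OF ab J c le] and f = mom_affine(1,3)[OF ab, of "j - v * (b - a) / 2" v]
  have p: "(b - a) * (j / 2 + v * (b - a) / 12) \<le> momP J a b"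
    using s(1) unfolding f by (simp add: field_simps)
  have "(b - a) * (j / 6) \<le> momZ J a b"
    using s(2) unfolding f by (simp add: field_simps)
  from mult_left_mono[OF this z] p show ?thesis by (simp add: field_simps)
qed

text \<open>Integration by parts: the kernel \<open>K\<close> is traded for its derivative \<open>J\<close>.\<close>

lemma kernel_moments:
  fixes a b :: real
  assumes ab: "a < b" and J: "continuous_on {a..b} J"
    and K: "\<And>s. s \<in> {a..b} \<Longrightarrow> (K has_real_derivative J s) (at s within {a..b})"
  shows "1 / (b - a) * integral {a..b} K = K b - momP J a b"
    and "1 / (b - a) * integral {a..b} K = K a + momM J a b"
    and "2 / (b - a)^2 * integral {a..b} (\<lambda>s. (s - (a + b) / 2) * K s) = momZ J a b"
proof -
  have d: "b - a \<noteq> 0" using ab by simp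
  have Kc: "continuous_on {a..b} K" using K by (meson DERIV_continuous_on)
  note i = mom_integrable[OF ab J]
  have Ki: "K integrable_on {a..b}" by (rule integrable_continuous_interval[OF Kc])
  have "((\<lambda>s. J s * ((s - a) / (b - a)) + 1 / (b - a) * K s) has_integral
      (K b * ((b - a) / (b - a)) - K a * ((a - a) / (b - a)))) {a..b}"
    using ab
    by (intro fundamental_theorem_of_calculus[where f = "\<lambda>s. K s * ((s - a) / (b - a))"])
      (auto intro!: derivative_eq_intros K simp: has_real_derivative_iff_has_vector_derivative[symmetric]
         field_simps)
  moreover have "((\<lambda>s. J s * ((s - a) / (b - a)) + 1 / (b - a) * K s) has_integral
      (momP J a b + 1 / (b - a) * integral {a..b} K)) {a..b}"
    unfolding momP_def by (intro has_integral_add has_integral_mult_right integrable_integral i Ki)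
  ultimately show "1 / (b - a) * integral {a..b} K = K b - momP J a b"
    using d by (auto dest: has_integral_unique)
  have "((\<lambda>s. J s * ((b - s) / (b - a)) - 1 / (b - a) * K s) has_integral
      (K b * ((b - b) / (b - a)) - K a * ((b - a) / (b - a)))) {a..b}"
    using ab
    by (intro fundamental_theorem_of_calculus[where f = "\<lambda>s. K s * ((b - s) / (b - a))"])
      (auto intro!: derivative_eq_intros K simp: has_real_derivative_iff_has_vector_derivative[symmetric]
         field_simps)
  moreover have "((\<lambda>s. J s * ((b - s) / (b - a)) - 1 / (b - a) * K s) has_integral
      (momM J a b - 1 / (b - a) * integral {a..b} K)) {a..b}"
    unfolding momM_def by (intro has_integral_diff has_integral_mult_right integrable_integral i Ki)
  ultimately show "1 / (b - a) * integral {a..b} K = K a + momM J a b"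
    using d by (auto dest: has_integral_unique)
  have Ki2: "(\<lambda>s. (s - (a + b) / 2) * K s) integrable_on {a..b}"
    by (intro integrable_continuous_interval continuous_intros Kc) auto
  \<comment> \<open>The quadratic factor vanishes at both ends, so no kernel value at a node
    survives in the formula for the second-order coefficient.\<close>
  let ?G = "\<lambda>s. K s * ((s - a) * (b - s) / (b - a)^2)"
  have "((\<lambda>s. J s * ((s - a) / (b - a) * ((b - s) / (b - a)))
      - 2 / (b - a)^2 * ((s - (a + b) / 2) * K s)) has_integral (?G b - ?G a)) {a..b}"
  proof (intro fundamental_theorem_of_calculus)
    fix x assume x: "x \<in> {a..b}"
    have "((\<lambda>s. (s - a) * (b - s)) has_real_derivative (b - x) - (x - a)) (at x within {a..b})"
      by (auto intro!: derivative_eq_intros)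
    then have "((\<lambda>s. (s - a) * (b - s) / (b - a)^2) has_real_derivative ((b - x) - (x - a)) / (b - a)^2) (at x within {a..b})"
      by (rule DERIV_cdivide)
    from DERIV_mult[OF K[OF x] this]
    have "(?G has_real_derivative J x * ((x - a) * (b - x) / (b - a)^2)
       + K x * (((b - x) - (x - a)) / (b - a)^2)) (at x within {a..b})"
      by (simp add: add.commute mult.commute)
    moreover have "J x * ((x - a) * (b - x) / (b - a)^2) + K x * (((b - x) - (x - a)) / (b - a)^2)
      = J x * ((x - a) / (b - a) * ((b - x) / (b - a))) - 2 / (b - a)^2 * ((x - (a + b) / 2) * K x)"
    proof -
      have "K x * ((b - x) - (x - a)) = - (2 * ((x - (a + b) / 2) * K x))" by (simp add: field_simps)
      then have *: "K x * (((b - x) - (x - a)) / (b - a)^2) = - (2 / (b - a)^2 * ((x - (a + b) / 2) * K x))"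
        by (metis times_divide_eq_left times_divide_eq_right minus_divide_left)
      show ?thesis unfolding * by (simp add: power2_eq_square)
    qed
    ultimately show "(?G has_vector_derivative J x * ((x - a) / (b - a) * ((b - x) / (b - a)))
      - 2 / (b - a)^2 * ((x - (a + b) / 2) * K x)) (at x within {a..b})"
      by (simp add: has_real_derivative_iff_has_vector_derivative[symmetric])
  qed (use ab in auto)
  moreover have "((\<lambda>s. J s * ((s - a) / (b - a) * ((b - s) / (b - a)))
      - 2 / (b - a)^2 * ((s - (a + b) / 2) * K s)) has_integral
      (momZ J a b - 2 / (b - a)^2 * integral {a..b} (\<lambda>s. (s - (a + b) / 2) * K s))) {a..b}"
    unfolding momZ_def by (intro has_integral_diff has_integral_mult_right integrable_integral i Ki2)
  ultimately have "?G b - ?G a = momZ J a b - 2 / (b - a)^2 * integral {a..b} (\<lambda>s. (s - (a + b) / 2) * K s)"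
    by (rule has_integral_unique)
  then show "2 / (b - a)^2 * integral {a..b} (\<lambda>s. (s - (a + b) / 2) * K s) = momZ J a b" by simp
qed

section \<open>The elliptic problem on the periodic grid\<close>

lemma grid_finite: "finite (grid M)" by (simp add: grid_def)

lemma grid_nonempty: "M \<ge> 1 \<Longrightarrow> grid M \<noteq> {}" by (auto simp: grid_def)

lemma maxnorm_le_iff:
  assumes "M \<ge> 1"
  shows "maxnorm M v \<le> c \<longleftrightarrow> (\<forall>p \<in> grid M. \<bar>v p\<bar> \<le> c)"
  unfolding maxnorm_def using grid_finite grid_nonempty[OF assms] by (subst Max_le_iff) auto

definition nbsum :: "nat \<Rightarrow> (nat \<times> nat \<Rightarrow> real) \<Rightarrow> nat \<times> nat \<Rightarrow> real" where
  "nbsum M v p = v ((fst p + 1) mod M, snd p) + v ((fst p + M - 1) mod M, snd p)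
     + v (fst p, (snd p + 1) mod M) + v (fst p, (snd p + M - 1) mod M)"

lemma lap_nbsum: "lap M h v p = (nbsum M v p - 4 * v p) / h\<^sup>2"
  by (simp add: lap_def nbsum_def split: prod.split)

lemma nbsum_mono:
  assumes "p \<in> grid M" "\<And>q. q \<in> grid M \<Longrightarrow> u q \<le> v q"
  shows "nbsum M u p \<le> nbsum M v p"
  unfolding nbsum_def
  by (intro add_mono assms) (use assms(1) in \<open>auto simp: grid_def\<close>)

lemma nbsum_cong:
  assumes "p \<in> grid M" "\<And>q. q \<in> grid M \<Longrightarrow> u q = v q"
  shows "nbsum M u p = nbsum M v p"
  using nbsum_mono[of p M u v] nbsum_mono[of p M v u] assms by force

lemma nbsum_linear: "nbsum M (\<lambda>q. x * u q + y * v q) p = x * nbsum M u p + y * nbsum M v p"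
  by (simp add: nbsum_def algebra_simps)

lemma nbsum_diff: "nbsum M (\<lambda>q. x - v q) p = 4 * x - nbsum M v p"
  by (simp add: nbsum_def algebra_simps)

lemma nbsum_const: "nbsum M (\<lambda>q. x) p = 4 * x"
  by (simp add: nbsum_def)

text \<open>At a grid point where u - v is maximal, the difference term and the increasing cube both
  have the favourable sign, so a positive maximum contradicts a > 0.\<close>

lemma comparison_principle:
  assumes a: "a > 0" and b: "b \<ge> 0" and c: "c \<ge> 0"
    and le: "\<And>p. p \<in> grid M \<Longrightarrow>
      a * u p + b * u p ^ 3 + c * (4 * u p - nbsum M u p)
      \<le> a * v p + b * v p ^ 3 + c * (4 * v p - nbsum M v p)"
    and p: "p \<in> grid M"
  shows "u p \<le> v p"
proof (rule ccontr)
  assume neg: "\<not> u p \<le> v p"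
  define m where "m = Max ((\<lambda>q. u q - v q) ` grid M)"
  have fin: "finite ((\<lambda>q. u q - v q) ` grid M)" by (simp add: grid_finite)
  have "m \<in> (\<lambda>q. u q - v q) ` grid M" unfolding m_def by (rule Max_in) (use p grid_finite in auto)
  then obtain q where q: "q \<in> grid M" "m = u q - v q" by auto
  have le_m: "u r - v r \<le> m" if "r \<in> grid M" for r unfolding m_def using fin that by simp
  from this[OF p] have "0 < m" using neg by simp
  have "nbsum M (\<lambda>r. 1 * u r + (-1) * v r) q \<le> nbsum M (\<lambda>r. m) q"
    by (rule nbsum_mono[OF q(1)]) (use le_m in auto)
  then have "nbsum M u q - nbsum M v q \<le> 4 * m" by (subst (asm) nbsum_linear) (simp add: nbsum_const)
  then have 1: "0 \<le> c * (4 * m - (nbsum M u q - nbsum M v q))" using c by simp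
  have "v q < u q" using \<open>0 < m\<close> q by simp
  then have "v q ^ 3 \<le> u q ^ 3" using power_mono_odd[of 3 "v q" "u q"] by simp
  then have 2: "0 \<le> b * (u q ^ 3 - v q ^ 3)" using b by simp
  have 3: "0 < a * m" using a \<open>0 < m\<close> by simp
  show False using le[OF q(1)] 1 2 3 q(2) by (simp add: algebra_simps)
qed

text \<open>Jacobi iteration: the neighbours are frozen and the increasing scalar function
  \<open>G\<close> is inverted at each point. From the constant subsolution -Z the iterates
  increase, and they stay below the constant supersolution Z.\<close>

lemma elliptic_existence:
  assumes a: "a > 0" and b: "b \<ge> 0" and c: "c \<ge> 0"
  shows "\<exists>u. \<forall>p \<in> grid M. a * u p + b * u p ^ 3 + c * (4 * u p - nbsum M u p) = (g p :: real)"
proof -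
  \<comment> \<open>Extension by 0 makes the iteration and its bounds valid at all index pairs, so
    no grid membership has to be carried along.\<close>
  define g' where "g' p = (if p \<in> grid M then g p else 0)" for p
  obtain Z where Z: "Z \<ge> 0" "\<And>p. \<bar>g' p\<bar> \<le> a * Z"
  proof
    define B where "B = (\<Sum>p\<in>grid M. \<bar>g p\<bar>)"
    have "\<bar>g' p\<bar> \<le> B" for p
    proof (cases "p \<in> grid M")
      case True
      then show ?thesis unfolding g'_def B_def using grid_finite by (auto intro: member_le_sum)
    next
      case False
      then show ?thesis by (simp add: g'_def B_def sum_nonneg)
    qed
    then show "\<bar>g' p\<bar> \<le> a * (B / a)" for p using a by simp
    show "0 \<le> B / a" using a by (simp add: B_def sum_nonneg)
  qed
  define G where "G x = (a + 4 * c) * x + b * x ^ 3" for x :: real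
  have k: "a + 4 * c > 0" using a c by simp
  have G_mono: "G x < G y" if "x < y" for x y
  proof -
    have "b * x ^ 3 \<le> b * y ^ 3" using b that power_mono_odd[of 3 x y] by (intro mult_left_mono) auto
    moreover have "(a + 4 * c) * x < (a + 4 * c) * y" using k that by simp
    ultimately show ?thesis by (simp add: G_def)
  qed
  have G_le: "G x \<le> G y \<longleftrightarrow> x \<le> y" for x y using G_mono[of x y] G_mono[of y x] by (cases x y rule: linorder_cases) auto
  have G_cont: "continuous_on A G" for A unfolding G_def by (intro continuous_intros)
  have "\<exists>x. G x = y" for y
  proof -
    define X where "X = \<bar>y\<bar> / (a + 4 * c)"
    have X: "X \<ge> 0" "(a + 4 * c) * X = \<bar>y\<bar>" using k by (auto simp: X_def)
    have "b * X ^ 3 \<ge> 0" using b X by simp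
    then have "G (- X) \<le> y" "y \<le> G X" using X by (auto simp: G_def)
    then show ?thesis using IVT'[of G "- X" y X] G_cont X by auto
  qed
  then obtain H where H: "G (H y) = y" for y by metis
  have H_mono: "H x \<le> H y" if "x \<le> y" for x y using that G_le[of "H x" "H y"] H by simp
  define U where "U = rec_nat (\<lambda>p. - Z) (\<lambda>_ u p. H (g' p + c * nbsum M u p))"
  have U0: "U 0 p = - Z" and US: "U (Suc i) p = H (g' p + c * nbsum M (U i) p)" for i p
    by (simp_all add: U_def)
  have nb: "nbsum M u p \<le> nbsum M v p" if "\<And>q. u q \<le> v q" for u v p
    unfolding nbsum_def by (intro add_mono that)
  have bZ: "b * Z ^ 3 \<ge> 0" using b Z by simp
  have up: "U i p \<le> Z" for i p
  proof (induction i arbitrary: p)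
    case 0 then show ?case using Z by (simp add: U0)
  next
    case (Suc i)
    have "nbsum M (U i) p \<le> 4 * Z" using nb[of "U i" "\<lambda>_. Z" p] Suc by (simp add: nbsum_const)
    then have "c * nbsum M (U i) p \<le> c * (4 * Z)" using c by (intro mult_left_mono) auto
    then have "g' p + c * nbsum M (U i) p \<le> G Z"
      using Z(2)[of p] bZ by (auto simp: G_def algebra_simps)
    then show ?case unfolding US using H G_le by metis
  qed
  have inc: "U i p \<le> U (Suc i) p" for i p
  proof (induction i arbitrary: p)
    case 0
    have "nbsum M (U 0) p = - 4 * Z" using nbsum_const[of M "-Z" p] by (simp add: U0[abs_def] U_def)
    then have "G (- Z) \<le> g' p + c * nbsum M (U 0) p"
      using Z(2)[of p] bZ by (auto simp: G_def algebra_simps)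
    then show ?case unfolding US U0 using H G_le by metis
  next
    case (Suc i)
    then show ?case unfolding US[of "Suc i"] US[of i]
      by (intro H_mono add_left_mono mult_left_mono nb c)
  qed
  have "\<exists>L. (\<lambda>i. U i p) \<longlonglongrightarrow> L" for p
    using incseq_convergent[of "\<lambda>i. U i p" Z] inc up by (metis incseq_SucI)
  then obtain u where u: "(\<lambda>i. U i p) \<longlonglongrightarrow> u p" for p by metis
  have "G (u p) = g' p + c * nbsum M u p" for p
  proof (rule LIMSEQ_unique)
    have "isCont G (u p)" using G_cont[of UNIV] by (simp add: continuous_on_eq_continuous_at)
    from isCont_tendsto_compose[OF this LIMSEQ_Suc[OF u]]
    show "(\<lambda>i. G (U (Suc i) p)) \<longlonglongrightarrow> G (u p)" .
    show "(\<lambda>i. G (U (Suc i) p)) \<longlonglongrightarrow> g' p + c * nbsum M u p"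
      unfolding US H nbsum_def by (intro tendsto_intros u)
  qed
  then have "a * u p + b * u p ^ 3 + c * (4 * u p - nbsum M u p) = g p" if "p \<in> grid M" for p
    using that by (simp add: G_def g'_def algebra_simps)
  then show ?thesis by blast
qed

section \<open>The bound on the step ratios\<close>

text \<open>Gives uniqueness of the root, so that the definite description in \<open>r_star\<close>
  equals any root supplied by the intermediate value theorem.\<close>

lemma rfun_strict_mono:
  assumes al: "0 < \<alpha>" "\<alpha> < 1" and r: "0 < r" "r < s"
  shows "rfun \<alpha> r < rfun \<alpha> s"
proof -
  define k where "k = 1 - \<alpha>/2"
  have k: "k > 0" using al by (simp add: k_def)
  have "2 * k * r / (1 + \<alpha> + k * r) \<le> 2 * k * s / (1 + \<alpha> + k * s)"
  proof -
    have pos: "0 < 1 + \<alpha> + k * r" "0 < 1 + \<alpha> + k * s" using al k r by (auto intro!: add_pos_pos)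
    have "k * (1 + \<alpha>) * r \<le> k * (1 + \<alpha>) * s" using k r al by (intro mult_left_mono) auto
    then have "2 * k * r * (1 + \<alpha> + k * s) \<le> 2 * k * s * (1 + \<alpha> + k * r)" by (simp add: algebra_simps)
    then show ?thesis using pos by (simp add: frac_le_eq divide_simps)
  qed
  moreover have "r / (1 + r) \<le> s / (1 + s)" using r by (simp add: divide_simps) (simp add: algebra_simps)
  ultimately have "sqrt (2 * k * r / (1 + \<alpha> + k * r) + r / (1 + r)) \<le> sqrt (2 * k * s / (1 + \<alpha> + k * s) + s / (1 + s))"
    by simp
  moreover have "1 / (s\<^sup>2 * (1 + s)) < 1 / (r\<^sup>2 * (1 + r))"
    using r by (intro divide_strict_left_mono mult_strict_mono power_strict_mono) auto
  ultimately show ?thesis unfolding rfun_def k_def[symmetric] by linarith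
qed

lemma r_star_lower:
  assumes al: "0 < \<alpha>" "\<alpha> < 1"
  shows "193/500 \<le> r_star \<alpha>"
proof -
  define k where "k = 1 - \<alpha>/2"
  have k: "1/2 < k" "k < 1" using al by (auto simp: k_def)
  \<comment> \<open>Only the first quotient depends on \<alpha>, and it is largest in the limit
    \<alpha> = 0, where the radicand becomes 3r/(1 + r). The value 193/500 lies just below the root
    of this limit case.\<close>
  have lo: "rfun \<alpha> (193/500) < 0"
  proof -
    have "2 * k * (193/500) / (1 + \<alpha> + k * (193/500)) \<le> 2 * (193/500) / (1 + (193/500))"
      using k al by (simp add: divide_simps k_def)
    then have "sqrt (2 * k * (193/500) / (1 + \<alpha> + k * (193/500)) + (193/500) / (1 + (193/500)))
        \<le> sqrt (3 * (193/500) / (1 + (193/500)))"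
      by (intro real_sqrt_le_mono) simp
    also have "\<dots> \<le> 9141/10000" by (rule real_le_lsqrt) (simp_all add: power2_eq_square)
    finally show ?thesis unfolding rfun_def k_def[symmetric] by (simp add: power2_eq_square)
  qed
  have hi: "0 \<le> rfun \<alpha> 1"
  proof -
    have "0 \<le> sqrt (2 * k * 1 / (1 + \<alpha> + k * 1) + 1 / (1 + 1))" using k al by simp
    then show ?thesis unfolding rfun_def k_def[symmetric] by simp
  qed
  have cont: "continuous_on {193/500..1} (rfun \<alpha>)"
  proof -
    have nz: "1 + \<alpha> + k * r \<noteq> 0" if "r \<in> {193/500..1}" for r
    proof -
      have "0 \<le> k * r" using that k by simp
      then show ?thesis using al by simp
    qed
    show ?thesis unfolding rfun_def[abs_def] k_def[symmetric]
      by (intro continuous_intros) (use nz in auto)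
  qed
  obtain r where r: "193/500 \<le> r" "r \<le> 1" "rfun \<alpha> r = 0"
    using IVT'[of "rfun \<alpha>" "193/500" 0 1] lo hi cont by auto
  have "r_star \<alpha> = r" unfolding r_star_def
  proof (rule the_equality)
    show "0 < r \<and> rfun \<alpha> r = 0" using r by simp
    show "s = r" if "0 < s \<and> rfun \<alpha> s = 0" for s
      using rfun_strict_mono[OF al, of s r] rfun_strict_mono[OF al, of r s] that r by (cases s r rule: linorder_cases) auto
  qed
  then show ?thesis using r by simp
qed

section \<open>Convolution weights\<close>

lemma powr_tangent:
  fixes u p :: real
  assumes "u > 0" "p \<le> 0"
  shows "1 + p * (u - 1) \<le> u powr p"
proof -
  have "p * (u - 1) \<le> p * ln u"
    using assms by (intro mult_left_mono_neg ln_le_minus_one) auto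
  then have "1 + p * (u - 1) \<le> 1 + p * ln u" by simp
  also have "\<dots> \<le> exp (p * ln u)" by (rule exp_ge_add_one_self)
  finally show ?thesis using assms by (simp add: powr_def)
qed

lemma abel_summation:
  fixes A v :: "nat \<Rightarrow> real"
  shows "(\<Sum>k = 1..Suc m. A k * (v k - v (k - 1)))
    = A (Suc m) * v (Suc m) - (\<Sum>k<Suc m. (if k = 0 then A 1 else A (Suc k) - A k) * v k)"
  by (induction m) (auto simp: algebra_simps)

text \<open>In the difference formula interval k also contributes to the increment k + 1; here all
  contributions to one increment are collected, with none from an earlier interval when k =
  1.\<close>

lemma shift_sum:
  fixes a x d :: "nat \<Rightarrow> real"
  shows "(\<Sum>k = 1..m. a k * d k + x k * d (Suc k)) + a (Suc m) * d (Suc m)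
    = (\<Sum>k = 1..Suc m. (a k + (if 2 \<le> k then x (k - 1) else 0)) * d k)"
  by (induction m) (auto simp: algebra_simps)

locale sigma_mesh =
  fixes \<alpha> :: real and t :: "nat \<Rightarrow> real" and N :: nat
  assumes alpha: "0 < \<alpha>" "\<alpha> < 1"
    and mesh: "\<And>k. k \<in> {1..N} \<Longrightarrow> t (k - 1) < t k"
    and ratio_lower: "\<And>k. 2 \<le> k \<Longrightarrow> k \<le> N \<Longrightarrow> 193/500 \<le> ratio t k"
begin

text \<open>The derivative of the kernel \<open>K n\<close>, positive and increasing on the left of
  \<open>tsig \<alpha> t n\<close>.\<close>

definition J :: "nat \<Rightarrow> real \<Rightarrow> real" where
  "J n s = \<alpha> / Gamma (1 - \<alpha>) * (tsig \<alpha> t n - s) powr (- 1 - \<alpha>)"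

definition K :: "nat \<Rightarrow> real \<Rightarrow> real" where
  "K n s = omega (1 - \<alpha>) (tsig \<alpha> t n - s)"

abbreviation P where "P n k \<equiv> momP (J n) (t (k - 1)) (t k)"
abbreviation Q where "Q n k \<equiv> momM (J n) (t (k - 1)) (t k)"
abbreviation Z where "Z n k \<equiv> momZ (J n) (t (k - 1)) (t k)"

text \<open>\<open>A n k\<close> is the coefficient of $\nabla_\tau v^k$ and \<open>- D n k\<close> that of $v^k$, $k < n$.\<close>

definition A :: "nat \<Rightarrow> nat \<Rightarrow> real" where
  "A n k = aL2 \<alpha> t n k
     + (if 2 \<le> k then zetaL2 \<alpha> t n (k - 1) / (ratio t k * (1 + ratio t k)) else 0)
     - (if k < n then zetaL2 \<alpha> t n k / (1 + ratio t (k + 1)) else 0)"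

definition D :: "nat \<Rightarrow> nat \<Rightarrow> real" where
  "D n k = (if k = 0 then A n 1 else A n (k + 1) - A n k)"

text \<open>The one contribution that lowers \<open>D n k\<close>; it stems from the interval before
  \<open>t (k - 1)\<close> and is therefore 0 for k <= 1.\<close>

definition bwd :: "nat \<Rightarrow> nat \<Rightarrow> real" where
  "bwd n k = (if 2 \<le> k then Z n (k - 1) / (ratio t k * (1 + ratio t k)) else 0)"

section \<open>Elementary facts about the mesh and the kernel\<close>

lemma gamma_pos: "Gamma (1 - \<alpha>) > 0"
  using alpha by (simp add: Gamma_real_pos)

lemma C_pos: "\<alpha> / Gamma (1 - \<alpha>) > 0"
  using alpha gamma_pos by simp

lemma mesh_Suc: "Suc k \<le> N \<Longrightarrow> t k < t (Suc k)"
  using mesh[of "Suc k"] by simp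

lemma mesh_mono: "i \<le> j \<Longrightarrow> j \<le> N \<Longrightarrow> t i \<le> t j"
  by (induction j rule: dec_induct) (use mesh_Suc in force)+

lemma tau_pos: "1 \<le> k \<Longrightarrow> k \<le> N \<Longrightarrow> 0 < tau t k"
  using mesh[of k] by (simp add: tau_def)

lemma ratio_pos: "2 \<le> k \<Longrightarrow> k \<le> N \<Longrightarrow> 0 < ratio t k"
  using ratio_lower[of k] by simp

lemma tau_ratio: "1 \<le> k \<Longrightarrow> Suc k \<le> N \<Longrightarrow> tau t (Suc k) = ratio t (Suc k) * tau t k"
  using tau_pos[of k] by (simp add: ratio_def)

lemma tsig_eq: "tsig \<alpha> t n - t (n - 1) = (1 - \<alpha>/2) * tau t n"
  by (simp add: tsig_def tau_def algebra_simps)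

lemma tsig_bounds:
  assumes "1 \<le> n" "n \<le> N"
  shows "t (n - 1) < tsig \<alpha> t n" "tsig \<alpha> t n \<le> t n"
proof -
  have "0 < (1 - \<alpha>/2) * tau t n" using alpha tau_pos[OF assms] by simp
  then show "t (n - 1) < tsig \<alpha> t n" using tsig_eq[of n] by simp
  have "0 \<le> (\<alpha>/2) * tau t n" using alpha tau_pos[OF assms] by simp
  then show "tsig \<alpha> t n \<le> t n" by (simp add: tsig_def tau_def algebra_simps)
qed

lemma below_tsig: "k < n \<Longrightarrow> n \<le> N \<Longrightarrow> s \<le> t k \<Longrightarrow> s < tsig \<alpha> t n"
  using tsig_bounds(1)[of n] mesh_mono[of k "n - 1"] by force

lemma K_eq: "K n s = (tsig \<alpha> t n - s) powr (- \<alpha>) / Gamma (1 - \<alpha>)"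
  by (simp add: K_def omega_def)

lemma K_deriv:
  assumes "s < tsig \<alpha> t n"
  shows "(K n has_real_derivative J n s) (at s within S)"
proof -
  have "((\<lambda>s. (tsig \<alpha> t n - s) powr (- \<alpha>)) has_real_derivative
      \<alpha> * (tsig \<alpha> t n - s) powr (- \<alpha> - 1)) (at s within S)"
    using assms by (auto intro!: derivative_eq_intros)
  from DERIV_cdivide[OF this, of "Gamma (1 - \<alpha>)"] show ?thesis
    by (simp add: K_eq[abs_def] J_def minus_diff_commute)
qed

lemma J_continuous:
  assumes "b < tsig \<alpha> t n"
  shows "continuous_on {a..b} (J n)"
  unfolding J_def[abs_def] using assms by (intro continuous_intros) auto

lemma J_mono: "r \<le> s \<Longrightarrow> s < tsig \<alpha> t n \<Longrightarrow> J n r \<le> J n s"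
  unfolding J_def using C_pos alpha by (intro mult_left_mono powr_mono2') auto

lemma J_pos: "s < tsig \<alpha> t n \<Longrightarrow> 0 < J n s"
  unfolding J_def using C_pos by (intro mult_pos_pos) auto

lemma K_pos: "s < tsig \<alpha> t n \<Longrightarrow> 0 < K n s"
  unfolding K_eq using gamma_pos by auto

context
  fixes n k :: nat
  assumes k: "1 \<le> k" and kn: "k < n" and nN: "n \<le> N"
begin

lemma int_lt: "t (k - 1) < t k"
  using mesh[of k] k kn nN by simp

lemma int_below: "t k < tsig \<alpha> t n"
  using below_tsig[of k n "t k"] kn nN by simp

lemma int_cont: "continuous_on {t (k - 1)..t k} (J n)"
  by (rule J_continuous[OF int_below])

text \<open>The coefficient is expressed through the kernel value at either endpoint, so that for
  two adjacent intervals the value at the common node can be made to cancel.\<close>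

lemma aL2_right: "aL2 \<alpha> t n k = K n (t k) - P n k"
  and aL2_left: "aL2 \<alpha> t n k = K n (t (k - 1)) + Q n k"
  and zetaL2_eq: "zetaL2 \<alpha> t n k = Z n k"
proof -
  have d: "(K n has_real_derivative J n s) (at s within {t (k - 1)..t k})" if "s \<in> {t (k - 1)..t k}" for s
    using that int_below by (intro K_deriv) simp
  note m = kernel_moments[OF int_lt int_cont d]
  show "aL2 \<alpha> t n k = K n (t k) - P n k" "aL2 \<alpha> t n k = K n (t (k - 1)) + Q n k"
    using m(1,2) int_below by (simp_all add: aL2_def tau_def K_def[abs_def])
  show "zetaL2 \<alpha> t n k = Z n k"
    using m(3) by (simp add: zetaL2_def tau_def K_def[abs_def])
qed

lemma J_lower: "s \<in> {t (k - 1)..t k} \<Longrightarrow> J n (t (k - 1)) \<le> J n s"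
  using int_below by (intro J_mono) auto

lemma P_lower: "tau t k * J n (t (k - 1)) / 2 \<le> P n k"
  and Z_lower: "tau t k * J n (t (k - 1)) / 6 \<le> Z n k"
  and Q_lower: "0 \<le> y \<Longrightarrow> y \<le> 1 \<Longrightarrow> tau t k * J n (t (k - 1)) * (1 / 2 - y / 6) \<le> Q n k - y * Z n k"
  using mom_bounds[OF int_lt int_cont J_lower] by (simp_all add: tau_def)

lemma Z_upper: "Z n k \<le> tau t k * J n (t k) / 6"
  using momZ_upper[OF int_lt int_cont, of "J n (t k)"] J_mono[of _ "t k" n] int_below by (simp add: tau_def)

lemma Z_nonneg: "0 \<le> Z n k"
  using Z_lower J_pos[of "t (k - 1)" n] int_below int_lt
  by (smt (verit) divide_nonneg_nonneg mult_nonneg_nonneg tau_def)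

end

text \<open>The closed form through which the step size conditions become lower bounds for a_0, and
  a fixed relation to the kernel value at \<open>t (n - 1)\<close>. With \<theta> = \<alpha>/2 the
  factor there is 1 - \<theta>/(1 - \<theta>).\<close>

lemma omega_last:
  assumes "1 \<le> n" "n \<le> N"
  shows "aL2 \<alpha> t n n = omega (2 - \<alpha>) (1 - \<alpha>/2) * tau t n powr (- \<alpha>)"
    and "(1 - \<alpha>) / (1 - \<alpha>/2) * aL2 \<alpha> t n n = K n (t (n - 1))"
proof -
  define T where "T = tsig \<alpha> t n"
  define a where "a = t (n - 1)"
  have aT: "a < T" "T \<le> t n" using tsig_bounds[OF assms] by (simp_all add: T_def a_def)
  have Ta: "T - a = (1 - \<alpha>/2) * tau t n" using tsig_eq[of n] by (simp add: T_def a_def)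
  have g: "Gamma (2 - \<alpha>) = (1 - \<alpha>) * Gamma (1 - \<alpha>)"
    using Gamma_plus1[of "1 - \<alpha>"] nonpos_Ints_nonpos[of "1 - \<alpha>"] alpha by auto
  have g2: "Gamma (2 - \<alpha>) \<noteq> 0" using g gamma_pos alpha by (metis less_irrefl mult_pos_pos diff_gt_0_iff_gt)
  have tp: "0 < tau t n" using tau_pos assms by simp
  let ?F = "\<lambda>s. - ((T - s) powr (1 - \<alpha>)) / Gamma (2 - \<alpha>)"
  have "((\<lambda>s. omega (1 - \<alpha>) (T - s)) has_integral ?F T - ?F a) {a..T}"
  \<comment> \<open>The kernel is singular at T; its antiderivative is continuous up to T, but a
    derivative exists only in the interior.\<close>
  proof (rule fundamental_theorem_of_calculus_interior)
    show "continuous_on {a..T} ?F"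
      using alpha g2 by (intro continuous_intros continuous_on_powr') auto
    fix s assume s: "s \<in> {a<..<T}"
    have "((\<lambda>s. (T - s) powr (1 - \<alpha>)) has_real_derivative - ((1 - \<alpha>) * (T - s) powr (- \<alpha>))) (at s)"
      using s by (auto intro!: derivative_eq_intros)
    from DERIV_cdivide[OF DERIV_minus[OF this], of "Gamma (2 - \<alpha>)"]
    show "(?F has_vector_derivative omega (1 - \<alpha>) (T - s)) (at s)"
      using alpha gamma_pos by (simp add: has_real_derivative_iff_has_vector_derivative[symmetric] g omega_def)
  qed (use aT in simp)
  note int = integral_unique[OF this]
  have a_eq: "aL2 \<alpha> t n n = (T - a) powr (1 - \<alpha>) / Gamma (2 - \<alpha>) / tau t n"
    by (simp add: aL2_def T_def[symmetric] a_def[symmetric] min_absorb2[OF aT(2)] int del: One_nat_def)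
  have pw: "tau t n powr (1 - \<alpha>) = tau t n powr (- \<alpha>) * tau t n"
    using tp powr_add[of "tau t n" "- \<alpha>" 1] by simp
  show 1: "aL2 \<alpha> t n n = omega (2 - \<alpha>) (1 - \<alpha>/2) * tau t n powr (- \<alpha>)"
    unfolding a_eq Ta using tp alpha by (simp add: powr_mult pw omega_def)
  have pw2: "(1 - \<alpha>/2) powr (1 - \<alpha>) = (1 - \<alpha>/2) powr (- \<alpha>) * (1 - \<alpha>/2)"
    using alpha powr_add[of "1 - \<alpha>/2" "- \<alpha>" 1] by simp
  have "K n (t (n - 1)) = (1 - \<alpha>/2) powr (- \<alpha>) * tau t n powr (- \<alpha>) / Gamma (1 - \<alpha>)"
    unfolding K_eq tsig_eq using alpha tp by (simp add: powr_mult)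
  moreover have "aL2 \<alpha> t n n = (1 - \<alpha>/2) powr (- \<alpha>) * (1 - \<alpha>/2) / ((1 - \<alpha>) * Gamma (1 - \<alpha>)) * tau t n powr (- \<alpha>)"
    unfolding 1 omega_def g pw2[symmetric] by simp
  moreover have "b / c * (p * c / (b * G) * q) = p * q / G" if "b \<noteq> 0" "c \<noteq> 0" for b c p q G :: real
    using that by simp
  ultimately show "(1 - \<alpha>) / (1 - \<alpha>/2) * aL2 \<alpha> t n n = K n (t (n - 1))"
    using alpha by simp
qed

lemma aL2_last_pos: "1 \<le> n \<Longrightarrow> n \<le> N \<Longrightarrow> 0 < aL2 \<alpha> t n n"
  using omega_last(1)[of n] tau_pos[of n] alpha by (simp add: omega_def Gamma_real_pos)

section \<open>The difference formula as a weighted sum of nodal values\<close>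

lemma L2sig_weights:
  assumes n: "1 \<le> n" "n \<le> N"
  shows "L2sig \<alpha> t n v = A n n * v n - (\<Sum>k<n. D n k * v k)"
proof -
  obtain m where m: "n = Suc m" using n by (cases n) auto
  then have m': "n - 1 = m" by simp
  let ?d = "\<lambda>k. v k - v (k - 1)"
  let ?x = "\<lambda>k. zetaL2 \<alpha> t n k / (ratio t (Suc k) * (1 + ratio t (Suc k)))"
  let ?w = "\<lambda>k. zetaL2 \<alpha> t n k / (1 + ratio t (Suc k))"
  have split: "aL2 \<alpha> t n k * ?d k + ((v (k + 1) - v k) - ratio t (k + 1) * ?d k)
      / (ratio t (k + 1) * (1 + ratio t (k + 1))) * zetaL2 \<alpha> t n k
    = (aL2 \<alpha> t n k * ?d k + ?x k * ?d (Suc k)) - ?w k * ?d k" if "k \<in> {1..m}" for k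
  proof -
    have "ratio t (Suc k) > 0" using that n m by (intro ratio_pos) auto
    then have r: "ratio t (Suc k) \<noteq> 0" "1 + ratio t (Suc k) \<noteq> 0" by auto
    have "(X - r * Y) / (r * (1 + r)) * z = z / (r * (1 + r)) * X - z / (1 + r) * Y"
      if "r \<noteq> 0" "1 + r \<noteq> 0" for X Y z r :: real
      using that by (simp add: divide_simps) (simp add: algebra_simps)
    from this[OF r] show ?thesis by simp
  qed
  have w: "(\<Sum>k = 1..m. ?w k * ?d k) = (\<Sum>k = 1..Suc m. (if k < n then ?w k else 0) * ?d k)"
    by (simp add: m)
  have "L2sig \<alpha> t n v = aL2 \<alpha> t n n * ?d n + (\<Sum>k = 1..m. (aL2 \<alpha> t n k * ?d k + ?x k * ?d (Suc k)) - ?w k * ?d k)"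
    unfolding L2sig_def m' by (intro arg_cong2[where f = "(+)"] refl sum.cong split)
  also have "\<dots> = ((\<Sum>k = 1..m. aL2 \<alpha> t n k * ?d k + ?x k * ?d (Suc k)) + aL2 \<alpha> t n (Suc m) * ?d (Suc m))
      - (\<Sum>k = 1..m. ?w k * ?d k)"
    by (simp add: sum_subtractf m)
  also have "\<dots> = (\<Sum>k = 1..Suc m. (aL2 \<alpha> t n k + (if 2 \<le> k then ?x (k - 1) else 0)) * ?d k)
      - (\<Sum>k = 1..Suc m. (if k < n then ?w k else 0) * ?d k)"
    by (simp only: shift_sum[of "aL2 \<alpha> t n" ?d ?x m] w)
  also have "\<dots> = (\<Sum>k = 1..Suc m. A n k * ?d k)"
    unfolding sum_subtractf[symmetric]
    by (rule sum.cong) (auto simp: A_def algebra_simps)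
  also have "\<dots> = A n n * v n - (\<Sum>k<n. D n k * v k)"
    unfolding abel_summation D_def m by (simp cong: if_cong)
  finally show ?thesis .
qed

text \<open>The formula annihilates constants, so the old weights add up to the new one. This allows
  the passage from \<phi> to 1 - \<phi>.\<close>

lemma D_sum:
  assumes "1 \<le> n" "n \<le> N"
  shows "(\<Sum>k<n. D n k) = A n n"
  using L2sig_weights[OF assms, of "\<lambda>_. 1"] by (simp add: L2sig_def)

lemma A_eq:
  assumes "1 \<le> k" "k \<le> n" "n \<le> N"
  shows "A n k = aL2 \<alpha> t n k + bwd n k - (if k < n then Z n k / (1 + ratio t (k + 1)) else 0)"
proof -
  have z: "zetaL2 \<alpha> t n j = Z n j" if "1 \<le> j" "j < n" for j
    using zetaL2_eq[of j n] that assms by simp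
  have "2 \<le> k \<Longrightarrow> zetaL2 \<alpha> t n (k - 1) = Z n (k - 1)" using z[of "k - 1"] assms by linarith
  then show ?thesis using z[of k] assms by (auto simp: A_def bwd_def)
qed

text \<open>Interval k + 1 is expanded at its left end and interval k at its right end, both at
  \<open>t k\<close>. With r = r_{k+1}, the two shares of \<open>Z n k\<close>, with factors 1/(r (1
  + r)) and 1/(1 + r), combine to 1/r.\<close>

lemma D_mid:
  assumes k: "1 \<le> k" "k + 2 \<le> n" "n \<le> N"
  shows "D n k = P n k + Z n k / ratio t (k + 1) + (Q n (k + 1) - 1 / (1 + ratio t (k + 2)) * Z n (k + 1)) - bwd n k"
proof -
  define r where "r = ratio t (Suc k)"
  have r: "r > 0" unfolding r_def using k by (intro ratio_pos) auto
  have "A n (Suc k) = K n (t k) + Q n (Suc k) + Z n k / (r * (1 + r)) - Z n (Suc k) / (1 + ratio t (k + 2))"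
    using k aL2_left[of "Suc k" n] by (simp add: A_eq bwd_def r_def)
  moreover have "A n k = K n (t k) - P n k + bwd n k - Z n k / (1 + r)"
    using k aL2_right[of k n] by (simp add: A_eq r_def)
  moreover have "z / (r * (1 + r)) + z / (1 + r) = z / r" for z
    using r by (simp add: divide_simps) (simp add: algebra_simps)
  from this[of "Z n k"] have "Z n k / (r * (1 + r)) + Z n k / (1 + r) = Z n k / r" .
  moreover have "D n k = A n (Suc k) - A n k" using k by (simp add: D_def)
  ultimately show ?thesis by (simp add: r_def)
qed

lemma D_zero:
  assumes "2 \<le> n" "n \<le> N"
  shows "D n 0 = K n (t 0) + (Q n 1 - 1 / (1 + ratio t 2) * Z n 1)"
  using aL2_left[of 1 n] zetaL2_eq[of 1 n] assms by (simp add: D_def A_def numeral_2_eq_2)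

text \<open>The subtracted term reduces a_0 exactly to the kernel value at \<open>t (n - 1)\<close>,
  which cancels as in \<open>D_mid\<close>. What remains has the same shape without the share of a
  following interval.\<close>

lemma D_last:
  assumes n: "2 \<le> n" "n \<le> N"
  shows "D n (n - 1) - (\<alpha>/2) / (1 - \<alpha>/2) * aL2 \<alpha> t n n
    = P n (n - 1) + Z n (n - 1) / ratio t n - bwd n (n - 1)"
proof -
  define r where "r = ratio t n"
  have r: "r > 0" unfolding r_def using n by (intro ratio_pos) auto
  have "A n n = aL2 \<alpha> t n n + Z n (n - 1) / (r * (1 + r))"
    using n by (simp add: A_eq bwd_def r_def)
  moreover have "A n (n - 1) = K n (t (n - 1)) - P n (n - 1) + bwd n (n - 1) - Z n (n - 1) / (1 + r)"
    using A_eq[of "n - 1" n] aL2_right[of "n - 1" n] n by (simp add: r_def)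
  moreover have "aL2 \<alpha> t n n - (\<alpha>/2) / (1 - \<alpha>/2) * aL2 \<alpha> t n n = K n (t (n - 1))"
    using omega_last(2)[of n] n alpha by (simp add: field_simps)
  moreover have "z / (r * (1 + r)) + z / (1 + r) = z / r" for z
    using r by (simp add: divide_simps) (simp add: algebra_simps)
  from this[of "Z n (n - 1)"] have "Z n (n - 1) / (r * (1 + r)) + Z n (n - 1) / (1 + r) = Z n (n - 1) / r" .
  moreover have "D n (n - 1) = A n n - A n (n - 1)" using n by (simp add: D_def)
  ultimately show ?thesis by (simp only: r_def[symmetric])
qed

lemma A_last_ge:
  assumes n: "1 \<le> n" "n \<le> N"
  shows "aL2 \<alpha> t n n \<le> A n n"
proof (cases "n = 1")
  case False
  then have "0 \<le> zetaL2 \<alpha> t n (n - 1)" "0 < ratio t n"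
    using zetaL2_eq[of "n - 1" n] Z_nonneg[of "n - 1" n] ratio_pos[of n] n by simp_all
  then show ?thesis by (simp add: A_def)
qed (simp add: A_def)

lemma D_one: "D 1 0 = aL2 \<alpha> t 1 1"
  by (simp add: D_def A_def)

end

section \<open>Bounds for the weights\<close>

text \<open>Frees the numerical estimates from the exponent 1 + \<alpha>: for v < 1 the largest
  exponent is the worst, for v >= 1 every power is at least 1.\<close>

lemma powr_lower_min:
  fixes v p :: real
  assumes "v > 0" "0 \<le> p" "p \<le> 2"
  shows "min 1 (v\<^sup>2) \<le> v powr p"
proof (cases "v \<le> 1")
  case True
  have "v\<^sup>2 = v powr 2" using assms by (simp add: powr_numeral)
  also have "\<dots> \<le> v powr p" using assms True by (intro powr_mono') auto
  finally show ?thesis by simp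
next
  case False
  then have "1 \<le> v powr p" using assms by (intro ge_one_powr_ge_zero) auto
  then show ?thesis by simp
qed

text \<open>The expression decreases in r, and 97/20 rounds up its value 4.842... at
  193/500.\<close>

lemma ratio_cubic_bound:
  fixes r :: real
  assumes "193/500 \<le> r"
  shows "1 / (r\<^sup>2 * (1 + r)) \<le> 97/20"
proof -
  have "(193/500)\<^sup>2 * (1 + 193/500) \<le> r\<^sup>2 * (1 + r)"
    using assms by (intro mult_mono power_mono) auto
  then have "20/97 \<le> r\<^sup>2 * (1 + r)" by (simp add: power2_eq_square)
  then have "1 / (r\<^sup>2 * (1 + r)) \<le> 1 / (20/97)" by (intro divide_left_mono) auto
  then show ?thesis by simp
qed

text \<open>Here $R = r_n$, $y = 1-\theta$, $z = 1/r_{n-1}$; \<open>E\<close> is proportional to a bound for the deficit in step $n$,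
  and $v$ is the quotient of the distances at which the kernels of steps $n$ and $n-1$ are evaluated.\<close>

lemma gain_bound:
  fixes R y z v p :: real
  assumes R: "20/37 \<le> R" and y: "1/2 \<le> y" "y \<le> 1" and z: "21/10 \<le> z" "z \<le> 500/193"
    and v: "v = (1 + y * R) / (y + z / 2)" and p: "0 \<le> p" "p \<le> 2"
  defines "E \<equiv> 16/45 * (37/20 - 1 / R)"
  shows "E \<le> z * (z / 6 + 1/20) * v powr p * (1 - E / (1 + R))" and "E / (1 + R) < 1"
proof -
  have Rpos: "R > 0" using R by simp
  have den: "0 < y + z / 2" using y z by simp
  have vpos: "v > 0" unfolding v using y Rpos den by (intro divide_pos_pos) (auto intro: add_pos_nonneg)
  define S where "S = z * (z / 6 + 1/20)"
  have S: "21/10 * (21/60 + 1/20) \<le> S" unfolding S_def using z by (intro mult_mono) auto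
  have vp: "min 1 (v\<^sup>2) \<le> v powr p" by (rule powr_lower_min[OF vpos p])
  \<comment> \<open>As S >= 0.84, constants up to 7/10 are safe when v >= 1; for v < 1 a lower bound
    w of v decides.\<close>
  have gain: "c \<le> S * v powr p" if "c \<le> 7/10" "c \<le> S * w\<^sup>2" "0 \<le> w" "w \<le> v" for c w
  proof -
    have "c \<le> S * min 1 (v\<^sup>2)"
    proof (cases "v\<^sup>2 \<le> 1")
      case True
      have "S * w\<^sup>2 \<le> S * v\<^sup>2" using that S by (intro mult_left_mono power_mono) auto
      then show ?thesis using that True by (simp add: min_def)
    next
      case False
      then show ?thesis using that S by (simp add: min_def)
    qed
    also have "\<dots> \<le> S * v powr p" using vp S by (intro mult_left_mono) auto
    finally show ?thesis .
  qed
  have E1: "E / (1 + R) < 1"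
  proof -
    have "E \<le> 16/45 * (37/20)" unfolding E_def using Rpos by (intro mult_left_mono) auto
    then have "E < 1 + R" using Rpos by simp
    then show ?thesis using Rpos by simp
  qed
  then show "E / (1 + R) < 1" .
  have "\<exists>c. c \<le> S * v powr p \<and> E \<le> c * (1 - E / (1 + R))"
  \<comment> \<open>The lower bound for v at R = 1 is least at y = 1/2, the one at R = 20/37 is
    least at y = 1; hence two cases with separate constants c.\<close>
  proof (cases "1 \<le> R")
    case True
    have w: "3 / (1 + z) \<le> v"
    proof -
      have "0 \<le> (2 * y - 1) * (z - 2)" using y z by (intro mult_nonneg_nonneg) auto
      then have "3 / (1 + z) \<le> (1 + y) / (y + z / 2)" using z den by (simp add: divide_simps) (simp add: algebra_simps)
      also have "\<dots> \<le> v" unfolding v using True y den by (intro divide_right_mono) auto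
      finally show ?thesis .
    qed
    have "7/10 \<le> S * (3 / (1 + z))\<^sup>2"
    proof -
      have "7/10 * (1 + z)\<^sup>2 \<le> 9 * S"
      proof -
        have "0 \<le> (z - 21/10) * (80 * z + 73)" using z by (intro mult_nonneg_nonneg) auto
        moreover have "9 * S - 7/10 * (1 + z)\<^sup>2 = (z - 21/10) * (80 * z + 73) / 100 + 833/1000"
          by (simp add: S_def field_simps power2_eq_square)
        ultimately show ?thesis by linarith
      qed
      then show ?thesis using z by (simp add: power_divide divide_simps)
    qed
    from gain[OF _ this _ w] have "7/10 \<le> S * v powr p" using z by simp
    moreover have "E \<le> 7/10 * (1 - E / (1 + R))"
    proof -
      \<comment> \<open>Because 1/R >= u, both occurrences of R can be expressed by u, which leaves
        a quadratic inequality with vertex at u = 59/280.\<close>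
      define u where "u = 1 / (1 + R)"
      have u: "0 < u" "u \<le> 1/R" unfolding u_def using Rpos by (auto simp: divide_simps)
      have "E \<le> 16/45 * (37/20 - u)" unfolding E_def using u by simp
      then have "E * (1 + 7/10 * u) \<le> 16/45 * (37/20 - u) * (1 + 7/10 * u)"
        using u by (intro mult_right_mono) auto
      also have "\<dots> \<le> 7/10"
      proof -
        have "7/10 - 16/45 * (37/20 - u) * (1 + 7/10 * u) = 16/45 * (7/10 * (u - 59/280)\<^sup>2 + 9819/112000)"
          by (simp add: field_simps power2_eq_square)
        also have "\<dots> \<ge> 0" by simp
        finally show ?thesis by simp
      qed
      finally have "E + E * (7/10 * u) \<le> 7/10" by (simp add: distrib_left)
      moreover have eu: "E / (1 + R) = E * u" by (simp add: u_def)
      ultimately show ?thesis unfolding eu by (simp add: algebra_simps)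
    qed
    ultimately show ?thesis by blast
  next
    case False
    have w: "(57/37 * 2) / (2 + z) \<le> v"
    proof -
      have "0 \<le> (1 - y) * (74 - 20 * z)" using y z by (intro mult_nonneg_nonneg) auto
      then have "(57/37 * 2) / (2 + z) \<le> (1 + y * (20/37)) / (y + z / 2)"
        using z den by (simp add: divide_simps) (simp add: algebra_simps)
      also have "\<dots> \<le> v" unfolding v using R y den by (intro divide_right_mono) auto
      finally show ?thesis .
    qed
    have "4/10 \<le> S * ((57/37 * 2) / (2 + z))\<^sup>2"
    proof -
      have "0 \<le> (z - 21/10) * (z + 1)" using z by (intro mult_nonneg_nonneg) auto
      then have le: "4/10 * (2 + z)\<^sup>2 \<le> (57/37 * 2)\<^sup>2 * S"
        using z unfolding S_def by (simp add: algebra_simps power2_eq_square)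
      have "0 < (2 + z)\<^sup>2" using z by simp
      from iffD2[OF pos_le_divide_eq[OF this] le]
      have "4/10 \<le> (57/37 * 2)\<^sup>2 * S / (2 + z)\<^sup>2" .
      also have "c\<^sup>2 * S / w\<^sup>2 = S * (c / w)\<^sup>2" for c w :: real by (simp add: power_divide)
      finally show ?thesis .
    qed
    from gain[OF _ this _ w] have "4/10 \<le> S * v powr p" using z by simp
    moreover have "E \<le> 4/10 * (1 - E / (1 + R))"
    proof -
      have "1 \<le> 1 / R" using False Rpos by simp
      then have E: "E \<le> 16/45 * (17/20)" unfolding E_def by simp
      have "E / (1 + R) \<le> 16/45 * (17/20) / (1 + 20/37)"
        using E R by (intro frac_le) auto
      then show ?thesis using E by simp
    qed
    ultimately show ?thesis by blast
  qed
  then obtain c where c: "c \<le> S * v powr p" "E \<le> c * (1 - E / (1 + R))" by blast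
  have "c * (1 - E / (1 + R)) \<le> S * v powr p * (1 - E / (1 + R))"
    using c E1 by (intro mult_right_mono) auto
  then show "E \<le> z * (z / 6 + 1/20) * v powr p * (1 - E / (1 + R))" using c by (simp add: S_def)
qed

section \<open>Signs of the old weights and their comparison between consecutive steps\<close>

context sigma_mesh
begin

text \<open>\<open>D n k\<close> before \<open>bwd n k\<close> is subtracted. This part is monotone
  in the kernel, the difference is not.\<close>

definition pos :: "nat \<Rightarrow> nat \<Rightarrow> real" where
  "pos n k = P n k + Z n k / ratio t (k + 1) + (Q n (k + 1) - 1 / (1 + ratio t (k + 2)) * Z n (k + 1))"

context
  fixes n k :: nat
  assumes k: "1 \<le> k" and kn: "k < n" and nN: "n \<le> N"
begin

lemma left_pos: "0 < tau t k * J n (t (k - 1))"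
  using tau_pos[of k] J_pos[of "t (k - 1)" n] below_tsig[of "k - 1" n] k kn nN by auto

lemma bwd_nonneg: "0 \<le> bwd n k"
  using Z_nonneg[of "k - 1" n] ratio_pos[of k] k kn nN by (auto simp: bwd_def)

text \<open>The kernel derivative at \<open>t (k - 1)\<close> bounds the moment of interval k - 1
  from above and those of interval k from below, so both can be measured in one unit. The conversion
  of the step lengths adds the second factor r.\<close>

lemma bwd_le_ratio:
  assumes "2 \<le> k"
  shows "bwd n k \<le> tau t k * J n (t (k - 1)) / 6 * (1 / ((ratio t k)\<^sup>2 * (1 + ratio t k)))"
proof -
  define r where "r = ratio t k"
  have r: "r > 0" unfolding r_def using ratio_pos[of k] assms kn nN by simp
  have Z: "Z n (k - 1) \<le> tau t (k - 1) * J n (t (k - 1)) / 6"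
    using Z_upper[of "k - 1" n] assms kn nN by simp
  have "tau t k = r * tau t (k - 1)"
    using tau_ratio[of "k - 1"] assms kn nN by (simp add: r_def)
  then have "tau t k * J n (t (k - 1)) / 6 * (1 / (r\<^sup>2 * (1 + r)))
      = tau t (k - 1) * J n (t (k - 1)) / 6 / (r * (1 + r))"
    using r by (simp add: power2_eq_square)
  moreover have "bwd n k \<le> tau t (k - 1) * J n (t (k - 1)) / 6 / (r * (1 + r))"
    unfolding bwd_def r_def[symmetric] using assms divide_right_mono[OF Z, of "r * (1 + r)"] r by simp
  ultimately show ?thesis by (simp add: r_def)
qed

lemma bwd_le: "bwd n k \<le> tau t k * J n (t (k - 1)) * (97/120)"
proof (cases "2 \<le> k")
  case True
  have "tau t k * J n (t (k - 1)) / 6 * (1 / ((ratio t k)\<^sup>2 * (1 + ratio t k)))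
    \<le> tau t k * J n (t (k - 1)) / 6 * (97/20)"
    using True ratio_lower[of k] kn nN left_pos by (intro mult_left_mono ratio_cubic_bound) auto
  from order_trans[OF bwd_le_ratio[OF True] this] show ?thesis by simp
next
  case False
  then show ?thesis using left_pos by (simp add: bwd_def)
qed

end

lemma unit_frac: "2 \<le> k \<Longrightarrow> k \<le> N \<Longrightarrow> 0 \<le> 1 / (1 + ratio t k) \<and> 1 / (1 + ratio t k) \<le> 1"
  using ratio_pos[of k] by simp

text \<open>In units of X the positive part is at least 1/2 + 1/(6r) + r/3; the mean inequality 1/r
  + 2r >= 2 sqrt 2, rounded down, gives 0.971 against at most 0.809. The fraction 333/400 lies
  slightly above the quotient, and \<open>D_compare\<close> spends the remaining 67/400.\<close>

lemma bwd_le_pos: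
  assumes k: "1 \<le> k" "k + 2 \<le> n" "n \<le> N"
  shows "bwd n k \<le> 333/400 * pos n k"
proof -
  define X where "X = tau t k * J n (t (k - 1))"
  have X: "X > 0" unfolding X_def using left_pos[of k n] k by simp
  define r where "r = ratio t (k + 1)"
  have r: "r > 0" unfolding r_def using ratio_pos[of "k + 1"] k by simp
  define y where "y = 1 / (1 + ratio t (k + 2))"
  have y: "0 \<le> y" "y \<le> 1" unfolding y_def using unit_frac[of "k + 2"] k by auto
  have P: "X / 2 \<le> P n k" and Z: "X / 6 \<le> Z n k"
    unfolding X_def using P_lower[of k n] Z_lower[of k n] k by simp_all
  have "tau t (k + 1) * J n (t k) * (1/2 - y/6) \<le> Q n (k + 1) - y * Z n (k + 1)"
    using Q_lower[of "k + 1" n y] k y by simp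
  moreover have "r * X * (1/3) \<le> tau t (k + 1) * J n (t k) * (1/2 - y/6)"
  proof -
    have "J n (t (k - 1)) \<le> J n (t k)"
      using J_lower[of k n "t k"] int_lt[of k n] k by simp
    then have "tau t k * J n (t (k - 1)) \<le> tau t k * J n (t k)"
      using tau_pos[of k] k by (intro mult_left_mono) auto
    then have "r * X \<le> tau t (k + 1) * J n (t k)"
      using tau_ratio[of k] k r by (simp add: X_def r_def mult.assoc mult_left_mono)
    moreover have "0 < r * X" using r X by simp
    ultimately show ?thesis using y by - (rule mult_mono, auto)
  qed
  moreover have "X / 6 / r \<le> Z n k / r" using Z r by (intro divide_right_mono) auto
  ultimately have p: "X / 2 + X / 6 / r + r * X * (1/3) \<le> pos n k"
    unfolding pos_def r_def[symmetric] y_def[symmetric] using P by simp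
  have "2828/1000 * r \<le> 1 + 2 * r\<^sup>2"
  proof -
    have "0 \<le> 2 * (r - 707/1000)\<^sup>2" by simp
    then show ?thesis by (simp add: power2_eq_square algebra_simps)
  qed
  then have "2828/1000 \<le> 1 / r + 2 * r" using r by (simp add: divide_simps power2_eq_square)
  from mult_left_mono[OF this, of "X / 6"] X
  have "5828/6000 * X \<le> X / 2 + X / 6 / r + r * X * (1/3)" by (simp add: algebra_simps)
  from order_trans[OF this p] have "5828/6000 * X \<le> pos n k" .
  moreover have "bwd n k \<le> X * (97/120)" unfolding X_def using bwd_le[of k n] k by simp
  ultimately show ?thesis using X by linarith
qed

lemma D_eq_pos:
  assumes "1 \<le> k" "k + 2 \<le> n" "n \<le> N"
  shows "D n k = pos n k - bwd n k"
  unfolding D_mid[OF assms] pos_def by simp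

lemma pos_nonneg:
  assumes "1 \<le> k" "k + 2 \<le> n" "n \<le> N"
  shows "0 \<le> pos n k"
  using bwd_le_pos[OF assms] bwd_nonneg[of k n] assms by simp

lemma D_zero_nonneg:
  assumes "2 \<le> n" "n \<le> N"
  shows "0 \<le> D n 0"
proof -
  define y where "y = 1 / (1 + ratio t 2)"
  have y: "0 \<le> y" "y \<le> 1" unfolding y_def using unit_frac[of 2] assms by auto
  have "0 \<le> tau t 1 * J n (t (1 - 1)) * (1/2 - y/6)"
    using left_pos[of 1 n] assms y by - (rule mult_nonneg_nonneg, auto)
  also have "\<dots> \<le> Q n 1 - y * Z n 1" using Q_lower[of 1 n y] assms y by simp
  finally show ?thesis
    unfolding D_zero[OF assms] y_def[symmetric] using K_pos[of "t 0" n] below_tsig[of 0 n "t 0"] assms by simp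
qed

lemma D_nonneg:
  assumes "k + 2 \<le> n" "n \<le> N"
  shows "0 \<le> D n k"
proof (cases "k = 0")
  case True then show ?thesis using D_zero_nonneg assms by simp
next
  case False
  then show ?thesis
    using D_eq_pos[of k n] bwd_le_pos[of k n] pos_nonneg[of k n] assms by simp
qed

text \<open>For k > 0 the weight of step n - 1 is bounded by its positive part, this by 1/g times
  that of step n, and \<open>D n k\<close> retains the fraction 67/400 of the latter.\<close>

lemma D_compare:
  assumes n: "k + 3 \<le> n" "n \<le> N"
    and g: "0 \<le> \<gamma>" "\<gamma> \<le> 67/400 * g"
    and J: "\<And>s. s \<le> t (n - 2) \<Longrightarrow> g * J (n - 1) s \<le> J n s"
    and K: "\<And>s. s \<le> t (n - 2) \<Longrightarrow> g * K (n - 1) s \<le> K n s"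
  shows "\<gamma> * D (n - 1) k \<le> D n k"
proof (cases "k = 0")
  case True
  define y where "y = 1 / (1 + ratio t 2)"
  have y: "0 \<le> y" "y \<le> 1" unfolding y_def using unit_frac[of 2] n by auto
  have 01: "t (1 - 1) < t 1" using int_lt[of 1 n] n by simp
  have le: "t 1 \<le> t (n - 2)" using mesh_mono[of 1 "n - 2"] n by simp
  have "g * (Q (n - 1) 1 - y * Z (n - 1) 1) \<le> Q n 1 - y * Z n 1"
    using n le by (intro mom_scale(3)[OF 01 int_cont[of 1 n] int_cont[of 1 "n - 1"] J y]) auto
  moreover have "g * K (n - 1) (t 0) \<le> K n (t 0)" using 01 le by (intro K) simp
  ultimately have "g * D (n - 1) 0 \<le> D n 0"
    using n by (simp add: D_zero y_def[symmetric] algebra_simps)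
  moreover have "\<gamma> * D (n - 1) 0 \<le> g * D (n - 1) 0"
    using g D_zero_nonneg[of "n - 1"] n by (intro mult_right_mono) auto
  ultimately show ?thesis using True by simp
next
  case False
  define r where "r = ratio t (k + 1)"
  have r: "r > 0" unfolding r_def using ratio_pos[of "k + 1"] False n by simp
  define y where "y = 1 / (1 + ratio t (k + 2))"
  have y: "0 \<le> y" "y \<le> 1" unfolding y_def using unit_frac[of "k + 2"] n by auto
  have le: "t k \<le> t (n - 2)" "t (k + 1) \<le> t (n - 2)" using n by (auto intro!: mesh_mono)
  have 1: "g * P (n - 1) k \<le> P n k" "g * Z (n - 1) k \<le> Z n k"
    using n le False
    by (auto intro!: mom_scale(1,2)[OF int_lt[of k n] int_cont[of k n] int_cont[of k "n - 1"] J] simp del: One_nat_def)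
  have 2: "g * (Q (n - 1) (k + 1) - y * Z (n - 1) (k + 1)) \<le> Q n (k + 1) - y * Z n (k + 1)"
    using n le False using int_lt[of "k + 1" n] int_cont[of "k + 1" n] int_cont[of "k + 1" "n - 1"]
    by (intro mom_scale(3)[OF _ _ _ J y]) auto
  have "g * Z (n - 1) k / r \<le> Z n k / r" using 1 r by (intro divide_right_mono) auto
  with 1 2 have p: "g * pos (n - 1) k \<le> pos n k"
    unfolding pos_def r_def[symmetric] y_def[symmetric] by (simp add: algebra_simps)
  have q: "0 \<le> pos (n - 1) k" using pos_nonneg[of k "n - 1"] n False by simp
  have "\<gamma> * D (n - 1) k \<le> \<gamma> * pos (n - 1) k"
    using g(1) D_eq_pos[of k "n - 1"] bwd_nonneg[of k "n - 1"] n False by (intro mult_left_mono) auto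
  also have "\<dots> \<le> 67/400 * g * pos (n - 1) k" using g q by (intro mult_right_mono) auto
  also have "\<dots> \<le> 67/400 * pos n k" using p by simp
  also have "\<dots> \<le> D n k" using D_eq_pos[of k n] bwd_le_pos[of k n] n False by simp
  finally show ?thesis .
qed

text \<open>The quotient of the distances from s to the two evaluation points is smallest at s =
  \<open>t (n - 2)\<close>. It is at most 1, so the power 1 + \<alpha> required for \<open>J\<close>
  also serves \<open>K\<close>.\<close>

lemma kernel_ratio:
  assumes n: "2 \<le> n" "n \<le> N"
  defines "y \<equiv> tsig \<alpha> t (n - 1) - t (n - 2)" and "x \<equiv> tsig \<alpha> t n - t (n - 2)"
  defines "g \<equiv> (y / x) powr (1 + \<alpha>)"
  assumes s: "s \<le> t (n - 2)"
  shows "g * J (n - 1) s \<le> J n s" and "g * K (n - 1) s \<le> K n s"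
proof -
  have y: "0 < y" unfolding y_def using below_tsig[of "n - 2" "n - 1" "t (n - 2)"] n by simp
  have yx: "y < x"
  proof -
    have "tsig \<alpha> t (n - 1) \<le> t (n - 1)" using tsig_bounds(2)[of "n - 1"] n by simp
    also have "\<dots> < tsig \<alpha> t n" using tsig_bounds(1)[of n] n by simp
    finally show ?thesis by (simp add: x_def y_def)
  qed
  define Y where "Y = tsig \<alpha> t (n - 1) - s"
  define X where "X = tsig \<alpha> t n - s"
  have Y: "y \<le> Y" and X: "X = Y + (x - y)" using s by (simp_all add: Y_def X_def x_def y_def)
  have pos: "0 < Y" "0 < X" "Y \<le> X" using y yx Y X by auto
  have "y * X \<le> Y * x"
  proof -
    have "y * (x - y) \<le> Y * (x - y)" using Y yx by (intro mult_right_mono) auto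
    then show ?thesis unfolding X by (simp add: algebra_simps)
  qed
  then have le: "y / x \<le> Y / X" using y yx pos by (simp add: divide_simps)
  have g1: "g \<le> (Y / X) powr (1 + \<alpha>)"
    unfolding g_def using le y yx alpha by (intro powr_mono2) auto
  also have "\<dots> = Y powr (1 + \<alpha>) / X powr (1 + \<alpha>)" using pos by (simp add: powr_divide)
  finally have g1': "g \<le> Y powr (1 + \<alpha>) / X powr (1 + \<alpha>)" .
  have "(Y / X) powr (1 + \<alpha>) \<le> (Y / X) powr \<alpha>"
    using pos alpha by (intro powr_mono') auto
  with g1 have g2: "g \<le> Y powr \<alpha> / X powr \<alpha>" using pos by (simp add: powr_divide)
  have "g * Y powr (- 1 - \<alpha>) \<le> Y powr (1 + \<alpha>) / X powr (1 + \<alpha>) * Y powr (- 1 - \<alpha>)"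
    using g1' by (intro mult_right_mono) auto
  also have "\<dots> = X powr (- 1 - \<alpha>)"
    using pos powr_minus[of X "1 + \<alpha>"] powr_minus[of Y "1 + \<alpha>"] by (simp add: field_simps)
  finally have "g * Y powr (- 1 - \<alpha>) \<le> X powr (- 1 - \<alpha>)" .
  from mult_left_mono[OF this, of "\<alpha> / Gamma (1 - \<alpha>)"] C_pos
  show "g * J (n - 1) s \<le> J n s" by (simp add: J_def X_def Y_def mult.left_commute)
  have "g * Y powr (- \<alpha>) \<le> Y powr \<alpha> / X powr \<alpha> * Y powr (- \<alpha>)"
    using g2 by (intro mult_right_mono) auto
  also have "\<dots> = X powr (- \<alpha>)"
    using pos powr_minus[of X \<alpha>] powr_minus[of Y \<alpha>] by (simp add: field_simps)
  finally have "g * Y powr (- \<alpha>) \<le> X powr (- \<alpha>)" .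
  from divide_right_mono[OF this, of "Gamma (1 - \<alpha>)"] gamma_pos
  show "g * K (n - 1) s \<le> K n s" by (simp add: K_eq X_def Y_def)
qed

section \<open>The weight of the most recent old value\<close>

lemma D_last_lower:
  assumes n: "3 \<le> n" "n \<le> N"
  defines "X \<equiv> tau t (n - 1) * J n (t (n - 2))"
  shows "X / 6 * (3 + 1 / ratio t n - 1 / ((ratio t (n - 1))\<^sup>2 * (1 + ratio t (n - 1))))
    \<le> D n (n - 1) - (\<alpha>/2) / (1 - \<alpha>/2) * aL2 \<alpha> t n n"
proof -
  define R where "R = ratio t n"
  have R: "R > 0" unfolding R_def using ratio_pos[of n] n by simp
  define q where "q = 1 / ((ratio t (n - 1))\<^sup>2 * (1 + ratio t (n - 1)))"
  have i: "n - 1 - 1 = n - 2" by simp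
  have "X / 2 \<le> P n (n - 1)" and Z: "X / 6 \<le> Z n (n - 1)"
    using P_lower[of "n - 1" n] Z_lower[of "n - 1" n] n unfolding X_def i by auto
  moreover have "X / 6 / R \<le> Z n (n - 1) / R" using Z R by (intro divide_right_mono) auto
  moreover have "bwd n (n - 1) \<le> X / 6 * q"
    using bwd_le_ratio[of "n - 1" n] n unfolding X_def q_def i by simp
  moreover have "D n (n - 1) - (\<alpha>/2) / (1 - \<alpha>/2) * aL2 \<alpha> t n n = P n (n - 1) + Z n (n - 1) / R - bwd n (n - 1)"
    unfolding R_def using D_last[of n] n by simp
  moreover have "X / 6 * (3 + 1 / R - q) = X / 2 + X / 6 / R - X / 6 * q"
    by (simp add: distrib_left right_diff_distrib)
  ultimately show ?thesis unfolding R_def[symmetric] q_def[symmetric] by linarith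
qed

text \<open>The value 10/21 is a rational just above the root of r^2 (1 + r) = 1/3; beyond it
  \<open>P\<close> alone pays for \<open>bwd\<close>, however large r_n is. For n = 2 there is no
  backward term.\<close>

lemma D_last_nonneg:
  assumes n: "2 \<le> n" "n \<le> N" and c: "n = 2 \<or> 10/21 \<le> ratio t (n - 1)"
  shows "(\<alpha>/2) / (1 - \<alpha>/2) * aL2 \<alpha> t n n \<le> D n (n - 1)"
proof (cases "n = 2")
  case True
  have "0 \<le> P n (n - 1)" using P_lower[of 1 n] left_pos[of 1 n] n True by simp
  moreover have "0 \<le> Z n (n - 1) / ratio t n" using Z_nonneg[of 1 n] ratio_pos[of n] n True by simp
  ultimately show ?thesis using D_last[OF n] True by (simp add: bwd_def)
next
  case False
  then have n3: "3 \<le> n" using n by simp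
  define r where "r = ratio t (n - 1)"
  have r: "10/21 \<le> r" using c False by (simp add: r_def)
  have "(10/21)\<^sup>2 * (1 + 10/21) \<le> r\<^sup>2 * (1 + r)"
    using r by (intro mult_mono power_mono) auto
  then have "1/3 \<le> r\<^sup>2 * (1 + r)" by (simp add: power2_eq_square)
  then have "1 / (r\<^sup>2 * (1 + r)) \<le> 1 / (1/3)" by (intro divide_left_mono) auto
  then have "1 / (r\<^sup>2 * (1 + r)) \<le> 3" by simp
  moreover have "0 \<le> 1 / ratio t n" using ratio_pos[of n] n by simp
  ultimately have "0 \<le> 3 + 1 / ratio t n - 1 / (r\<^sup>2 * (1 + r))" by linarith
  moreover have "0 \<le> tau t (n - 1) * J n (t (n - 2))"
  proof -
    have i: "n - 1 - 1 = n - 2" "1 \<le> n - 1" "n - 1 < n" using n3 by auto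
    from left_pos[OF i(2,3) n(2)] show ?thesis unfolding i(1) by simp
  qed
  ultimately have "0 \<le> tau t (n - 1) * J n (t (n - 2)) / 6 * (3 + 1 / ratio t n - 1 / (r\<^sup>2 * (1 + r)))"
    by simp
  with D_last_lower[OF n3 n(2)] show ?thesis unfolding r_def by linarith
qed

text \<open>The share of interval n - 2 is at least X/2 + 2.1 X/6 = 0.85 X and covers
  \<open>bwd\<close>. The share of interval n - 1 is left over, measured in the same unit as the
  deficit in \<open>D_last_lower\<close>.\<close>

lemma D_penultimate_lower:
  assumes n: "3 \<le> n" "n \<le> N" and r: "ratio t (n - 1) \<le> 10/21"
  shows "tau t (n - 1) * J n (t (n - 2)) / 6 * (3 - 1 / (1 + ratio t n)) \<le> D n (n - 2)"
proof -
  have i: "n - 2 + 1 = n - 1" "n - 2 + 2 = n" "n - 1 - 1 = n - 2" using n by auto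
  define X where "X = tau t (n - 2) * J n (t (n - 2 - 1))"
  have X: "X > 0" unfolding X_def using left_pos[of "n - 2" n] n by simp
  define \<rho> where "\<rho> = ratio t (n - 1)"
  have \<rho>: "0 < \<rho>" "\<rho> \<le> 10/21" unfolding \<rho>_def using ratio_pos[of "n - 1"] n r by auto
  have P: "X / 2 \<le> P n (n - 2)" and Z: "X / 6 \<le> Z n (n - 2)"
    unfolding X_def using P_lower[of "n - 2" n] Z_lower[of "n - 2" n] n by simp_all
  have "X / 6 * (21/10) \<le> Z n (n - 2) / \<rho>"
  proof -
    have "21/10 \<le> 1 / \<rho>" using \<rho> by (simp add: divide_simps)
    then have "X / 6 * (21/10) \<le> Z n (n - 2) * (1 / \<rho>)" using Z X by (intro mult_mono) auto
    then show ?thesis by simp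
  qed
  moreover have "bwd n (n - 2) \<le> X * (97/120)" unfolding X_def using bwd_le[of "n - 2" n] n by simp
  moreover define W where "W = tau t (n - 1) * J n (t (n - 2))"
  define y where "y = 1 / (1 + ratio t n)"
  have y: "0 \<le> y" "y \<le> 1" unfolding y_def using unit_frac[of n] n by auto
  then have "W * (1/2 - y/6) \<le> Q n (n - 1) - y * Z n (n - 1)"
    using Q_lower[of "n - 1" n y] n unfolding i W_def by simp
  moreover have "D n (n - 2) = P n (n - 2) + Z n (n - 2) / \<rho> + (Q n (n - 1) - y * Z n (n - 1)) - bwd n (n - 2)"
    using D_mid[of "n - 2" n] n unfolding i \<rho>_def y_def by simp
  moreover have "W / 6 * (3 - y) = W * (1/2 - y/6)" by (simp add: field_simps)
  ultimately have "W / 6 * (3 - y) \<le> D n (n - 2)" using P X by linarith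
  then show ?thesis unfolding y_def W_def .
qed

text \<open>The tangent line of the convex function \<open>J\<close> at the midpoint captures the growth of the kernel.\<close>

lemma D_last_convex:
  assumes n: "3 \<le> n" "n \<le> N" and r: "ratio t (n - 1) \<le> 10/21"
  defines "z \<equiv> 1 / ratio t (n - 1)" and "m \<equiv> n - 1"
  shows "tau t m * (\<alpha> / Gamma (1 - \<alpha>)) * (tau t m * (1 - \<alpha>/2 + z / 2)) powr (- 1 - \<alpha>) * (z * (z / 6 + 1/20))
     \<le> D m (m - 1) - (\<alpha>/2) / (1 - \<alpha>/2) * aL2 \<alpha> t m m"
proof -
  define \<rho> where "\<rho> = ratio t m"
  have \<rho>: "193/500 \<le> \<rho>" "\<rho> \<le> 10/21" unfolding \<rho>_def m_def using ratio_lower[of "n - 1"] n r by auto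
  have z: "z = 1 / \<rho>" "21/10 \<le> z" unfolding z_def \<rho>_def m_def[symmetric]
    using \<rho> by (auto simp: \<rho>_def divide_simps)
  have mN: "2 \<le> m" "m \<le> N" using n by (auto simp: m_def)
  define \<tau> where "\<tau> = tau t m"
  have \<tau>: "\<tau> > 0" unfolding \<tau>_def using tau_pos[of m] mN by simp
  define y where "y = 1 - \<alpha>/2"
  have y: "1/2 < y" "y < 1" using alpha by (auto simp: y_def)
  define a where "a = t (m - 1 - 1)"
  define b where "b = t (m - 1)"
  have ab: "a < b" unfolding a_def b_def using int_lt[of "m - 1" m] mN by simp
  have "\<tau> = \<rho> * tau t (m - 1)" using tau_ratio[of "m - 1"] mN by (simp add: \<tau>_def \<rho>_def)
  then have ba: "b - a = z * \<tau>" using \<rho> z by (simp add: tau_def a_def b_def)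
  have Tb: "tsig \<alpha> t m - b = y * \<tau>" unfolding b_def \<tau>_def y_def by (rule tsig_eq)
  define C where "C = \<alpha> / Gamma (1 - \<alpha>)"
  have C: "C > 0" unfolding C_def by (rule C_pos)
  define ym where "ym = \<tau> * (y + z / 2)"
  have ym: "ym > 0" unfolding ym_def using \<tau> y z(2) by simp
  have Tm: "tsig \<alpha> t m - (a + b) / 2 = ym" unfolding ym_def using Tb ba by (simp add: field_simps)
  define j where "j = C * ym powr (- 1 - \<alpha>)"
  have j: "j > 0" unfolding j_def using C ym by simp
  define v where "v = j * (1 + \<alpha>) / ym"
  have tan: "j + v * (s - (a + b) / 2) \<le> J m s" if s: "s \<in> {a..b}" for s
  proof -
    define Y where "Y = tsig \<alpha> t m - s"
    have "0 < tsig \<alpha> t m - b" unfolding Tb using y \<tau> by simp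
    then have Y: "Y > 0" unfolding Y_def using s by simp
    have "1 + (- 1 - \<alpha>) * (Y / ym - 1) \<le> (Y / ym) powr (- 1 - \<alpha>)"
      using Y ym alpha by (intro powr_tangent) auto
    from mult_left_mono[OF this, of j] j
    have "j * (1 + (- 1 - \<alpha>) * (Y / ym - 1)) \<le> j * (Y / ym) powr (- 1 - \<alpha>)" by simp
    also have "\<dots> = C * Y powr (- 1 - \<alpha>)" unfolding j_def using Y ym by (simp add: powr_divide)
    also have "j * (1 + (- 1 - \<alpha>) * (Y / ym - 1)) = j + v * (s - (a + b) / 2)"
    proof -
      have "Y = ym - (s - (a + b) / 2)" unfolding Y_def Tm[symmetric] by simp
      then have e: "Y / ym - 1 = - ((s - (a + b) / 2) / ym)" using ym by (simp add: diff_divide_distrib)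
      have "j * (1 + (- 1 - \<alpha>) * - (w / ym)) = j + j * (1 + \<alpha>) / ym * w" for w
        by (simp add: algebra_simps add_divide_distrib)
      then show ?thesis unfolding e v_def .
    qed
    finally show ?thesis by (simp add: J_def C_def Y_def)
  qed
  have cont: "continuous_on {a..b} (J m)"
    unfolding a_def b_def using mN by (intro int_cont) auto
  have "(b - a) * (j * (1 / 2 + z / 6) + v * (b - a) / 12) \<le> P m (m - 1) + z * Z m (m - 1)"
    using mom_tangent[OF ab cont _ tan, of z] z(2) unfolding a_def b_def by simp
  moreover have "j * (z / (y + z / 2)) \<le> v * (b - a)"
  proof -
    have "v * (b - a) = j * (1 + \<alpha>) * (z / (y + z / 2))"
      unfolding v_def ba ym_def using \<tau> by simp
    moreover have "0 \<le> j * \<alpha> * (z / (y + z / 2))" using j alpha y z(2) by simp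
    moreover have "j * (1 + \<alpha>) * h = j * h + j * \<alpha> * h" for h by (simp add: algebra_simps)
    note this[of "z / (y + z / 2)"]
    ultimately show ?thesis by linarith
  qed
  then have "j * (1 / 2 + z / 6) + j * (z / (y + z / 2)) / 12 \<le> j * (1 / 2 + z / 6) + v * (b - a) / 12"
    by (intro add_left_mono divide_right_mono) auto
  then have "(b - a) * (j * (1 / 2 + z / 6) + j * (z / (y + z / 2)) / 12)
     \<le> (b - a) * (j * (1 / 2 + z / 6) + v * (b - a) / 12)" using ab by (intro mult_left_mono) auto
  moreover have "bwd m (m - 1) \<le> (b - a) * (j * ((y + z / 2) / (y + z))) * (97/120)"
  proof -
    \<comment> \<open>Between the midpoint and the far end a the kernel derivative decays at least
      like the inverse first power of the distance.\<close>
    have "J m a \<le> j * ((y + z / 2) / (y + z))"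
    proof -
      have Ta: "tsig \<alpha> t m - a = \<tau> * (y + z)" using Tb ba by (simp add: algebra_simps)
      define u where "u = (y + z) / (y + z / 2)"
      have u: "1 \<le> u" unfolding u_def using y z(2) by simp
      have "\<tau> * (y + z) = ym * u" unfolding ym_def u_def using y z(2) by simp
      then have "J m a = j * u powr (- 1 - \<alpha>)"
        unfolding J_def Ta j_def C_def[symmetric] using ym u by (simp add: powr_mult)
      also have "\<dots> \<le> j * u powr (- 1)" using u alpha j by (intro mult_left_mono powr_mono) auto
      also have "u powr (- 1) = (y + z / 2) / (y + z)" using u y z(2) by (simp add: powr_minus u_def)
      finally show ?thesis .
    qed
    then have "(b - a) * J m a * (97/120) \<le> (b - a) * (j * ((y + z / 2) / (y + z))) * (97/120)"
      using ab by (intro mult_right_mono mult_left_mono) auto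
    moreover have "bwd m (m - 1) \<le> (b - a) * J m a * (97/120)"
      using bwd_le[of "m - 1" m] mN by (simp add: tau_def a_def b_def)
    ultimately show ?thesis by simp
  qed
  moreover have "(b - a) * j * (z / 6 + 1/20)
    \<le> (b - a) * (j * (1 / 2 + z / 6) + j * (z / (y + z / 2)) / 12) - (b - a) * (j * ((y + z / 2) / (y + z))) * (97/120)"
  proof -
    \<comment> \<open>Both extreme values belong to y = 1 and z = 21/10. The constant 1/20 arises
      from 1/2 + 7/82 - (41/62)(97/120), which is slightly larger.\<close>
    have h1: "7/82 * 12 \<le> z / (y + z / 2)"
    proof -
      have "7/82 * 12 * (y + z / 2) \<le> 7/82 * 12 * (1 + z / 2)" using y by simp
      also have "\<dots> \<le> z" using z(2) by simp
      finally show ?thesis using y z(2) by (simp add: pos_le_divide_eq)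
    qed
    have h2: "(y + z / 2) / (y + z) \<le> 41/62"
    proof -
      have "62 * (y + z / 2) \<le> 41 * (y + z)" using y z(2) by simp
      then show ?thesis using y z(2) by (simp add: divide_simps)
    qed
    have "e * j * (z / 6 + 1/20) \<le> e * (j * (1 / 2 + z / 6) + j * h / 12) - e * (j * w) * (97/120)"
      if "7/82 * 12 \<le> h" "w \<le> 41/62" "0 < e" for h w e
    proof -
      have "z / 6 + 1/20 \<le> (1 / 2 + z / 6) + h / 12 - w * (97/120)" using that by simp
      then have "(e * j) * (z / 6 + 1/20) \<le> (e * j) * ((1 / 2 + z / 6) + h / 12 - w * (97/120))"
        using that(3) j by (intro mult_left_mono) auto
      also have "\<dots> = e * (j * (1 / 2 + z / 6) + j * h / 12) - e * (j * w) * (97/120)"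
        by (simp add: algebra_simps)
      finally show ?thesis .
    qed
    from this[OF h1 h2, of "b - a"] ab show ?thesis by (simp only: diff_gt_0_iff_gt)
  qed
  moreover have "D m (m - 1) - (\<alpha>/2) / (1 - \<alpha>/2) * aL2 \<alpha> t m m = P m (m - 1) + z * Z m (m - 1) - bwd m (m - 1)"
    unfolding D_last[OF mN] z(1) \<rho>_def by simp
  moreover have "(b - a) * j * (z / 6 + 1/20) = tau t m * C * ym powr (- 1 - \<alpha>) * (z * (z / 6 + 1/20))"
    unfolding ba j_def \<tau>_def by simp
  ultimately show ?thesis unfolding C_def ym_def y_def \<tau>_def by linarith
qed

lemma D_le_A:
  assumes "1 \<le> n" "n \<le> N"
  shows "D n (n - 1) \<le> A n n"
proof -
  have "A n n = (\<Sum>k<n. D n k)" using D_sum[OF assms] by simp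
  also have "\<dots> = (\<Sum>k<n - 1. D n k) + D n (n - 1)"
    using assms sum.lessThan_Suc[of "D n" "n - 1"] by simp
  finally show ?thesis
    using sum_nonneg[of "{..<n - 1}" "D n"] D_nonneg[of _ n] assms by (simp add: less_diff_conv)
qed

text \<open>\<gamma> is the deficit divided by \<open>A m m - b / 16\<close>, where b/16 is reserved
  for the negative part of the cubic. The next two inequalities let the old weights of step n absorb
  \<gamma> times those of step m; the last two give the pointwise domination of u^{m-1} by
  u^m.\<close>

lemma deficient_weight:
  assumes n: "2 \<le> n" "n \<le> N"
    and neg: "D n (n - 1) < (\<alpha>/2) / (1 - \<alpha>/2) * aL2 \<alpha> t n n"
  defines "m \<equiv> n - 1"
  defines "b \<equiv> aL2 \<alpha> t m m"
  obtains \<gamma> where "0 \<le> \<gamma>" "2 \<le> m"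
    and "(\<alpha>/2) / (1 - \<alpha>/2) * aL2 \<alpha> t n n - D n (n - 1) = \<gamma> * (A m m - b / 16)"
    and "\<And>k. k + 2 \<le> m \<Longrightarrow> \<gamma> * D m k \<le> D n k"
    and "\<gamma> * (D m (m - 1) + b / 16) \<le> D n (m - 1)"
    and "\<gamma> * (1 - \<alpha>/2) \<le> \<alpha>/2"
    and "\<gamma> * (\<alpha>/2) * (A m m + b)
      \<le> (D m (m - 1) - (\<alpha>/2) / (1 - \<alpha>/2) * b) * (\<alpha>/2 - \<gamma> * (1 - \<alpha>/2))"
proof -
  have "\<not> (n = 2 \<or> 10/21 \<le> ratio t (n - 1))" using D_last_nonneg[OF n] neg by linarith
  then have n3: "3 \<le> n" and r21: "ratio t (n - 1) \<le> 10/21" using n by auto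
  have mN: "2 \<le> m" "1 \<le> m" "m \<le> N" and i: "n - 2 = m - 1" "n - 1 = m" using n3 n by (auto simp: m_def)
  define \<theta> where "\<theta> = \<alpha>/2"
  have \<theta>: "0 < \<theta>" "\<theta> < 1/2" using alpha by (auto simp: \<theta>_def)
  define y where "y = 1 - \<theta>"
  have y: "1/2 < y" "y < 1" using \<theta> by (auto simp: y_def)
  define d where "d = \<theta> / y * aL2 \<alpha> t n n - D n m"
  have d: "0 < d" using neg by (simp add: d_def \<theta>_def y_def m_def)
  define R where "R = ratio t n"
  have R: "0 < R" unfolding R_def using ratio_pos[of n] n by simp
  define \<rho> where "\<rho> = ratio t m"
  have \<rho>: "193/500 \<le> \<rho>" "\<rho> \<le> 10/21"
    unfolding \<rho>_def using r21 ratio_lower[of m] mN i by auto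
  define \<tau> where "\<tau> = tau t m"
  have \<tau>: "0 < \<tau>" unfolding \<tau>_def using tau_pos mN by simp
  define \<kappa> where "\<kappa> = \<tau> * J n (t (m - 1))"
  have \<kappa>: "0 < \<kappa>" unfolding \<kappa>_def \<tau>_def using left_pos[of m n] mN n m_def by simp
  \<comment> \<open>37/20 is 97/20 - 3. The factor 16/45 = (1/6)(32/15) is a normalisation that
    makes \<gamma> (B + b) <= \<kappa> E.\<close>
  define E where "E = 16/45 * (37/20 - 1 / R)"
  have d_le: "d \<le> \<kappa> * (15/32 * E)"
  proof -
    have "\<kappa> / 6 * (3 + 1 / R - 1 / (\<rho>\<^sup>2 * (1 + \<rho>))) \<le> - d"
      using D_last_lower[OF n3 n(2)] unfolding i d_def \<kappa>_def \<tau>_def R_def \<rho>_def \<theta>_def y_def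
      by (simp only: minus_diff_eq)
    moreover have "\<kappa> / 6 * (3 + 1 / R - 97/20) \<le> \<kappa> / 6 * (3 + 1 / R - 1 / (\<rho>\<^sup>2 * (1 + \<rho>)))"
      using \<kappa> ratio_cubic_bound[OF \<rho>(1)] by (intro mult_left_mono) auto
    moreover have "\<kappa> / 6 * (3 + 1 / R - 97/20) = - (\<kappa> * (15/32 * E))"
      by (simp add: E_def algebra_simps)
    ultimately show ?thesis by linarith
  qed
  have E: "0 < E"
  proof (rule ccontr)
    assume "\<not> 0 < E"
    then have "\<kappa> * (15/32 * E) \<le> 0" using \<kappa> by (intro mult_nonneg_nonpos) auto
    then show False using d d_le by linarith
  qed
  have R_lower: "20/37 \<le> R"
  proof -
    have "1 / R < 37/20" using E by (simp add: E_def)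
    then show ?thesis using R by (simp add: divide_simps)
  qed
  have E_le: "E \<le> 16/45 * (37/20)" unfolding E_def using R by simp
  have b: "0 < b" unfolding b_def using aL2_last_pos mN by simp
  define B where "B = A m m"
  have B: "b \<le> B" unfolding B_def b_def using A_last_ge mN by simp
  define z where "z = 1 / \<rho>"
  have z: "21/10 \<le> z" "z \<le> 500/193" unfolding z_def using \<rho> by (auto simp: divide_simps)
  define v where "v = (1 + y * R) / (y + z / 2)"
  have v: "0 < v" unfolding v_def using y R z by (intro divide_pos_pos add_pos_nonneg) auto
  have gain: "E \<le> z * (z / 6 + 1/20) * v powr (1 + \<alpha>) * (1 - E / (1 + R))" "E / (1 + R) < 1"
    using gain_bound[OF R_lower _ _ z v_def, of "1 + \<alpha>"] y alpha unfolding E_def by auto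
  define C where "C = \<alpha> / Gamma (1 - \<alpha>)"
  have C: "0 < C" unfolding C_def by (rule C_pos)
  define x where "x = \<tau> * (1 + y * R)"
  have x: "0 < x" unfolding x_def using \<tau> y R by (simp add: add_pos_nonneg)
  have x_eq: "tsig \<alpha> t n - t (m - 1) = x"
  proof -
    have "tau t n = R * \<tau>" using tau_ratio[of m] mN n m_def by (simp add: R_def \<tau>_def)
    then have "tsig \<alpha> t n - t m = y * (R * \<tau>)"
      using tsig_eq[of n] unfolding i y_def \<theta>_def by simp
    moreover have "t m - t (m - 1) = \<tau>" by (simp add: \<tau>_def tau_def)
    ultimately show ?thesis by (simp add: x_def algebra_simps)
  qed
  have y_eq: "tsig \<alpha> t m - t (m - 1) = y * \<tau>" using tsig_eq[of m] by (simp add: y_def \<theta>_def \<tau>_def)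
  have \<kappa>_eq: "\<kappa> = \<tau> * C * x powr (- 1 - \<alpha>)"
    unfolding \<kappa>_def J_def x_eq C_def by simp
  define g where "g = (y * \<tau> / x) powr (1 + \<alpha>)"
  have g: "0 < g" unfolding g_def using y \<tau> x by simp
  have yx: "y * \<tau> / x = y / (1 + y * R)" unfolding x_def using \<tau> by simp
  have "0 < y * R" using y R by simp
  then have yx1: "y / (1 + y * R) \<le> 1" using y by simp
  have g_le: "g \<le> y / (1 + y * R)"
  proof -
    have "g \<le> (y / (1 + y * R)) powr 1"
      unfolding g_def yx using alpha yx1 y R by (intro powr_mono') auto
    then show ?thesis using y R by (simp add: add_pos_nonneg)
  qed
  define c where "c = 2 * \<theta> * (1 - 2 * \<theta>) / y\<^sup>2"
  have c: "0 < c" unfolding c_def using \<theta> y by simp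
  \<comment> \<open>The unit \<kappa> of the deficit is b times the kernel quotient g times a factor
    of \<alpha> alone; this converts the bound of d by \<kappa> into a bound of \<gamma> by
    g.\<close>
  have \<kappa>_b: "\<kappa> = b * g * c"
  proof -
    have "(1 - \<alpha>) / y * b = K m (t (m - 1))"
      using omega_last(2)[of m] mN by (simp add: b_def y_def \<theta>_def)
    moreover have "b = y / (1 - \<alpha>) * ((1 - \<alpha>) / y * b)" using alpha y by simp
    ultimately have "b = y / (1 - \<alpha>) * ((y * \<tau>) powr (- \<alpha>) / Gamma (1 - \<alpha>))"
      unfolding K_eq y_eq by simp
    moreover have "g = (y * \<tau>) powr (1 + \<alpha>) * x powr (- 1 - \<alpha>)"
      unfolding g_def using y \<tau> x powr_minus[of x "1 + \<alpha>"] by (simp add: powr_divide field_simps)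
    moreover have "(y * \<tau>) powr (- \<alpha>) * (y * \<tau>) powr (1 + \<alpha>) = y * \<tau>"
      using y \<tau> powr_add[of "y * \<tau>" "- \<alpha>" "1 + \<alpha>"] by simp
    ultimately have "b * g = y / (1 - \<alpha>) * (y * \<tau>) * x powr (- 1 - \<alpha>) / Gamma (1 - \<alpha>)"
      by (metis (no_types, opaque_lifting) mult.assoc mult.left_commute times_divide_eq_left times_divide_eq_right)
    moreover have "c = \<alpha> * (1 - \<alpha>) / y\<^sup>2" unfolding c_def \<theta>_def by simp
    ultimately have "b * g * c = (y / (1 - \<alpha>) * (y * \<tau>) * x powr (- 1 - \<alpha>) / Gamma (1 - \<alpha>)) * (\<alpha> * (1 - \<alpha>) / y\<^sup>2)"
      by simp
    also have "\<dots> = \<kappa>"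
    proof -
      have aux: "(y / e * (y * \<tau>) * X / G) * (a * e / y\<^sup>2) = \<tau> * (a / G) * X" if "e \<noteq> 0" for e X G a
        using that y by (simp add: power2_eq_square)
      show ?thesis unfolding \<kappa>_eq C_def by (rule aux) (use alpha in simp)
    qed
    finally show ?thesis by simp
  qed
  define B' where "B' = B - b / 16"
  have B': "15/16 * b \<le> B'" "0 < B'" unfolding B'_def using B b by auto
  define \<gamma> where "\<gamma> = d / B'"
  have \<gamma>: "0 < \<gamma>" "\<gamma> * B' = d" unfolding \<gamma>_def using d B' by auto
  have \<gamma>_le: "\<gamma> \<le> E / 2 * (g * c)"
  proof -
    have "\<gamma> \<le> \<kappa> * (15/32 * E) / (15/16 * b)"
    proof -
      have "0 \<le> \<kappa> * (15/32 * E)" using d d_le by linarith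
      then show ?thesis unfolding \<gamma>_def using d_le B'(1) b by (intro frac_le) auto
    qed
    also have "\<dots> = E / 2 * (g * c)" unfolding \<kappa>_b using b by simp
    finally show ?thesis .
  qed
  \<comment> \<open>The quotient (B + s b)/(B - b/16) decreases in B, so its worst value occurs at B
    = b.\<close>
  have mass: "\<gamma> * (B + s * b) \<le> (16 + 16 * s) / 15 * d" if "0 \<le> s" for s
  proof -
    have "B + s * b \<le> (16 + 16 * s) / 15 * B'"
    proof -
      have "0 \<le> (1 + 16 * s) * (B - b)" using that B by simp
      then show ?thesis unfolding B'_def by (simp add: field_simps)
    qed
    then have "\<gamma> * (B + s * b) \<le> \<gamma> * ((16 + 16 * s) / 15 * B')"
      using \<gamma>(1) by (intro mult_left_mono) auto
    also have "\<dots> = (16 + 16 * s) / 15 * (\<gamma> * B')" by simp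
    finally show ?thesis unfolding \<gamma>(2) .
  qed
  have c2: "\<gamma> * D m k \<le> D n k" if k: "k + 2 \<le> m" for k
  proof -
    have "c \<le> 1/2"
    proof -
      have "0 \<le> (1 - 3 * \<theta>)\<^sup>2" by simp
      then have "4 * \<theta> * (1 - 2 * \<theta>) \<le> y\<^sup>2" unfolding y_def by (simp add: power2_eq_square algebra_simps)
      then show ?thesis unfolding c_def using y by (simp add: divide_simps)
    qed
    \<comment> \<open>Numerically \<gamma> <= 0.1645 g, just inside the fraction 67/400 = 0.1675
      left by \<open>bwd_le_pos\<close>.\<close>
    then have "E / 2 * (g * c) \<le> (16/45 * (37/20)) / 2 * (g * (1/2))"
      using E E_le g c by (intro mult_mono) auto
    from order_trans[OF \<gamma>_le this] have "\<gamma> \<le> 67/400 * g" using g by simp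
    moreover note kernel_ratio[OF n, unfolded i y_eq x_eq, folded g_def]
    ultimately show ?thesis
      using D_compare[of k n \<gamma> g] k n \<gamma> unfolding i by (simp add: m_def)
  qed
  have c3: "\<gamma> * (D m (m - 1) + b / 16) \<le> D n (m - 1)"
  proof -
    have "\<gamma> * (D m (m - 1) + b / 16) \<le> \<gamma> * (B + 1/16 * b)"
      using D_le_A[of m] mN \<gamma> by (intro mult_left_mono) (auto simp: B_def)
    also have "\<dots> \<le> 17/15 * d" using mass[of "1/16"] by simp
    also have "\<dots> \<le> 17/15 * (\<kappa> * (15/32 * E))" using d_le by (intro mult_left_mono) auto
    also have "\<dots> \<le> \<kappa> / 6 * (3 - 1 / (1 + R))"
    proof -
      have "1 / (1 + R) \<le> 1 / R" using R by (simp add: divide_simps)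
      moreover have "0 < 1 / R" using R by simp
      moreover have "17/15 * (37/20 - q) \<le> 3 - p" if "p \<le> q" "0 < q" for p q :: real
        using that by simp
      ultimately have "17/15 * (37/20 - 1 / R) \<le> 3 - 1 / (1 + R)" by blast
      from mult_left_mono[OF this, of "\<kappa> / 6"] \<kappa> show ?thesis by (simp add: E_def)
    qed
    also have "\<dots> \<le> D n (m - 1)"
      using D_penultimate_lower[OF n3 n(2) r21] unfolding i \<kappa>_def \<tau>_def R_def .
    finally show ?thesis .
  qed
  define W where "W = D m (m - 1) - \<theta> / y * b"
  have W: "\<kappa> * (z * (z / 6 + 1/20) * v powr (1 + \<alpha>)) \<le> W"
  proof -
    have "\<tau> * C * (\<tau> * (y + z / 2)) powr (- 1 - \<alpha>) * (z * (z / 6 + 1/20)) \<le> W"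
      using D_last_convex[OF n3 n(2) r21]
      unfolding i W_def \<tau>_def C_def y_def \<theta>_def z_def \<rho>_def b_def .
    moreover have "(\<tau> * (y + z / 2)) powr (- 1 - \<alpha>) = x powr (- 1 - \<alpha>) * v powr (1 + \<alpha>)"
    proof -
      \<comment> \<open>v compares x with the distance from the evaluation point of step m to the
        midpoint of the preceding interval; it brings the surplus from \<open>D_last_convex\<close>
        to the unit \<kappa>.\<close>
      have xv: "x = \<tau> * (y + z / 2) * v" unfolding x_def v_def using y z by simp
      have "v powr (- 1 - \<alpha>) * v powr (1 + \<alpha>) = 1"
        using v powr_add[of v "- 1 - \<alpha>" "1 + \<alpha>"] by simp
      then show ?thesis unfolding xv using v \<tau> y z by (simp add: powr_mult mult.assoc)
    qed
    ultimately show ?thesis unfolding \<kappa>_eq by (simp add: mult_ac)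
  qed
  have imp: "\<gamma> * y \<le> \<theta> * (E / (1 + R))"
  proof -
    have "\<gamma> * y \<le> E / 2 * (g * c) * y" using \<gamma>_le y by (intro mult_right_mono) auto
    also have "\<dots> = \<theta> * (E * (g * ((1 - 2 * \<theta>) / y)))"
      unfolding c_def using y by (simp add: field_simps power2_eq_square)
    also have "\<dots> \<le> \<theta> * (E * (1 / (1 + R)))"
    proof -
      have "g * ((1 - 2 * \<theta>) / y) \<le> y / (1 + y * R) * ((1 - 2 * \<theta>) / y)"
        using g_le \<theta> y by (intro mult_right_mono) auto
      also have "\<dots> = (1 - 2 * \<theta>) / (1 + y * R)" using y by simp
      also have "\<dots> \<le> 1 / (1 + R)"
      proof -
        have "(1 - 2 * \<theta>) * (1 + R) \<le> 1 + y * R" unfolding y_def using \<theta> R by (simp add: algebra_simps)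
        moreover have "0 < 1 + y * R" using y R by (simp add: add_pos_nonneg)
        ultimately show ?thesis using R by (simp add: divide_simps)
      qed
      finally show ?thesis using E \<theta> by (intro mult_left_mono) auto
    qed
    finally show ?thesis by simp
  qed
  have c5: "\<gamma> * y \<le> \<theta>"
  proof -
    have "\<theta> * (E / (1 + R)) \<le> \<theta> * 1" using gain(2) \<theta> by (intro mult_left_mono) auto
    with imp show ?thesis by simp
  qed
  have c4: "\<gamma> * \<theta> * (B + b) \<le> W * (\<theta> - \<gamma> * y)"
  proof -
    have "\<gamma> * (B + b) \<le> 32/15 * d" using mass[of 1] by simp
    also have "\<dots> \<le> 32/15 * (\<kappa> * (15/32 * E))" using d_le by (intro mult_left_mono) auto
    also have "\<dots> = \<kappa> * E" by simp
    also have "\<dots> \<le> \<kappa> * (z * (z / 6 + 1/20) * v powr (1 + \<alpha>) * (1 - E / (1 + R)))"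
      using gain(1) \<kappa> by (intro mult_left_mono) auto
    also have "\<dots> \<le> W * (1 - E / (1 + R))"
      using W gain(2) mult_right_mono[OF W, of "1 - E / (1 + R)"] by (simp add: mult.assoc)
    finally have "\<theta> * (\<gamma> * (B + b)) \<le> \<theta> * (W * (1 - E / (1 + R)))" using \<theta> by (intro mult_left_mono) auto
    also have "\<dots> = W * (\<theta> - \<theta> * (E / (1 + R)))" by (simp add: algebra_simps)
    also have "\<dots> \<le> W * (\<theta> - \<gamma> * y)"
    proof -
      have "0 \<le> \<kappa> * (z * (z / 6 + 1/20) * v powr (1 + \<alpha>))" using \<kappa> z v by simp
      with W have "0 \<le> W" by linarith
      then show ?thesis using imp by (intro mult_left_mono) auto
    qed
    finally show ?thesis by (simp add: mult_ac)
  qed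
  show thesis
  proof (rule that[of \<gamma>])
    show "0 \<le> \<gamma>" using \<gamma> by simp
    show "2 \<le> m" by (rule mN(1))
    show "(\<alpha>/2) / (1 - \<alpha>/2) * aL2 \<alpha> t n n - D n (n - 1) = \<gamma> * (A m m - b / 16)"
      using \<gamma>(2) unfolding d_def B'_def B_def y_def \<theta>_def i by simp
    show "\<gamma> * D m k \<le> D n k" if "k + 2 \<le> m" for k using c2 that .
    show "\<gamma> * (D m (m - 1) + b / 16) \<le> D n (m - 1)" by (rule c3)
    show "\<gamma> * (1 - \<alpha>/2) \<le> \<alpha>/2" using c5 unfolding y_def \<theta>_def .
    show "\<gamma> * (\<alpha>/2) * (A m m + b)
      \<le> (D m (m - 1) - (\<alpha>/2) / (1 - \<alpha>/2) * b) * (\<alpha>/2 - \<gamma> * (1 - \<alpha>/2))"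
      using c4 unfolding W_def B_def y_def \<theta>_def .
  qed
qed

end

section \<open>The maximum bound principle\<close>

lemma cubic_upper: "2 * u - 3 * u\<^sup>2 + u ^ 3 \<le> 2 * u" if "0 \<le> u" "u \<le> 2" for u :: real
proof -
  have "0 \<le> u\<^sup>2 * (3 - u)" using that by simp
  then show ?thesis by (simp add: algebra_simps power2_eq_square power3_eq_cube)
qed

text \<open>For u > 0 the quotient by u is (1 - u)(2 - u), with minimum -1/4 at u = 3/2. The margins
  of one sixteenth of a_0 compensate for this negative part.\<close>

lemma cubic_lower: "- (u / 4) \<le> 2 * u - 3 * u\<^sup>2 + u ^ 3" if "0 \<le> u" for u :: real
proof -
  have "0 \<le> u * (u - 3/2)\<^sup>2" using that by simp
  then show ?thesis by (simp add: algebra_simps power2_eq_square power3_eq_cube)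
qed

text \<open>The step size conditions restated as lower bounds for a_0; \<open>c\<close> stands for
  \<epsilon>^2/h^2.\<close>

locale allen_cahn_mesh = sigma_mesh +
  fixes M :: nat and c :: real
  assumes c_nonneg: "0 \<le> c"
    and step_reaction: "\<And>n. n \<in> {1..N} \<Longrightarrow> 2 * (1 - \<alpha>/2) / (\<alpha>/2) \<le> aL2 \<alpha> t n n"
    and step_diffusion: "\<And>n. n \<in> {1..N} \<Longrightarrow> 4 * c \<le> aL2 \<alpha> t n n"
begin

text \<open>The conditions 2 (1 - \<theta>) <= \<theta> a_0 and 4 c <= a_0, the latter times 1 -
  \<theta>, add up to the first bound. Since \<theta> < 1/2, the former also gives a_0 >= 4 (1 -
  \<theta>), from which the remaining margins follow.\<close>

lemma step_bounds:
  assumes n: "1 \<le> n" "n \<le> N"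
  shows "(1 - \<alpha>/2) * (2 + 4 * c) \<le> aL2 \<alpha> t n n"
    and "(\<alpha>/2) * (2 + 4 * c) \<le> (\<alpha>/2) / (1 - \<alpha>/2) * aL2 \<alpha> t n n"
    and "(1 - \<alpha>/2) / 4 \<le> aL2 \<alpha> t n n / 16"
    and "(\<alpha>/2) / 4 \<le> aL2 \<alpha> t n n / 16"
    and "0 < A n n - (1 - \<alpha>/2)"
proof -
  define \<theta> where "\<theta> = \<alpha>/2"
  have \<theta>: "0 < \<theta>" "\<theta> < 1/2" using alpha by (auto simp: \<theta>_def)
  define a where "a = aL2 \<alpha> t n n"
  have a: "0 < a" unfolding a_def using aL2_last_pos n by simp
  have r: "2 * (1 - \<theta>) \<le> \<theta> * a" using step_reaction[of n] n \<theta> unfolding \<theta>_def[symmetric] a_def[symmetric]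
    by (simp add: divide_simps mult.commute)
  have d: "4 * c \<le> a" using step_diffusion[of n] n by (simp add: a_def)
  have "(1 - \<theta>) * (4 * c) \<le> (1 - \<theta>) * a" using d \<theta> by (intro mult_left_mono) auto
  with r have 1: "(1 - \<theta>) * (2 + 4 * c) \<le> a" by (simp add: algebra_simps)
  then show "(1 - \<alpha>/2) * (2 + 4 * c) \<le> aL2 \<alpha> t n n" by (simp add: \<theta>_def a_def)
  have "\<theta> / (1 - \<theta>) * ((1 - \<theta>) * (2 + 4 * c)) \<le> \<theta> / (1 - \<theta>) * a"
    using 1 \<theta> by (intro mult_left_mono) auto
  then show "(\<alpha>/2) * (2 + 4 * c) \<le> (\<alpha>/2) / (1 - \<alpha>/2) * aL2 \<alpha> t n n"
    using \<theta> by (simp add: \<theta>_def[symmetric] a_def[symmetric])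
  have "\<theta> * a \<le> 1/2 * a" using \<theta> a by (intro mult_right_mono) auto
  with r have 2: "4 * (1 - \<theta>) \<le> a" by simp
  then show "(1 - \<alpha>/2) / 4 \<le> aL2 \<alpha> t n n / 16" by (simp add: \<theta>_def a_def)
  show "(\<alpha>/2) / 4 \<le> aL2 \<alpha> t n n / 16" using 2 \<theta> by (simp add: \<theta>_def[symmetric] a_def[symmetric])
  show "0 < A n n - (1 - \<alpha>/2)" using 2 \<theta> A_last_ge[OF n] by (simp add: \<theta>_def[symmetric] a_def[symmetric])
qed

definition rhs :: "nat \<Rightarrow> (nat \<Rightarrow> nat \<times> nat \<Rightarrow> real) \<Rightarrow> nat \<times> nat \<Rightarrow> real" where
  "rhs n v p = (\<Sum>k<n. D n k * v k p) - (\<alpha>/2) * fAC (v (n - 1) p)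
     - (\<alpha>/2) * c * (4 * v (n - 1) p - nbsum M (v (n - 1)) p)"

text \<open>The linear part of (1 - \<theta>) f is merged into the coefficient of
  \<open>x p\<close>, which leaves a monotone nonlinearity.\<close>

definition lhs :: "nat \<Rightarrow> (nat \<times> nat \<Rightarrow> real) \<Rightarrow> nat \<times> nat \<Rightarrow> real" where
  "lhs n x p = (A n n - (1 - \<alpha>/2)) * x p + (1 - \<alpha>/2) * x p ^ 3
     + (1 - \<alpha>/2) * c * (4 * x p - nbsum M x p)"

lemma rhs_cong:
  assumes "1 \<le> n" "p \<in> grid M" "\<And>k q. k < n \<Longrightarrow> q \<in> grid M \<Longrightarrow> v k q = w k q"
  shows "rhs n v p = rhs n w p"
proof -
  have "nbsum M (v (n - 1)) p = nbsum M (w (n - 1)) p" using assms by (intro nbsum_cong) auto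
  moreover have "(\<Sum>k<n. D n k * v k p) = (\<Sum>k<n. D n k * w k p)" using assms by (intro sum.cong) auto
  moreover have "v (n - 1) p = w (n - 1) p" using assms by simp
  ultimately show ?thesis by (simp only: rhs_def)
qed

lemma lhs_mono:
  assumes "1 \<le> n" "n \<le> N" and "\<And>p. p \<in> grid M \<Longrightarrow> lhs n u p \<le> lhs n v p" and "p \<in> grid M"
  shows "u p \<le> v p"
proof (rule comparison_principle[where a = "A n n - (1 - \<alpha>/2)" and b = "1 - \<alpha>/2" and c = "(1 - \<alpha>/2) * c"])
  show "0 < A n n - (1 - \<alpha>/2)" using step_bounds(5) assms by simp
qed (use assms(3,4) alpha c_nonneg in \<open>auto simp: lhs_def\<close>)

lemma lhs_surj:
  assumes "1 \<le> n" "n \<le> N"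
  shows "\<exists>x. \<forall>p \<in> grid M. lhs n x p = f p"
  unfolding lhs_def using step_bounds(5)[OF assms] alpha c_nonneg
  by (intro elliptic_existence) auto

text \<open>This is \<open>A n n - rhs n v p\<close> rewritten for u = 1 - v, so that the upper
  barrier condition becomes a sign condition on a function of nonnegative data.\<close>

definition defect :: "nat \<Rightarrow> (nat \<Rightarrow> nat \<times> nat \<Rightarrow> real) \<Rightarrow> nat \<times> nat \<Rightarrow> real" where
  "defect n u p = (\<Sum>k<n. D n k * u k p) - (\<alpha>/2) * (2 * u (n - 1) p - 3 * (u (n - 1) p)\<^sup>2 + u (n - 1) p ^ 3)
     - (\<alpha>/2) * c * (4 * u (n - 1) p - nbsum M (u (n - 1)) p)"

lemma defect_rhs:
  assumes "1 \<le> n" "n \<le> N"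
  shows "defect n (\<lambda>k q. 1 - v k q) p = A n n - rhs n v p"
proof -
  have s: "(\<Sum>k<n. D n k * (1 - v k p)) = A n n - (\<Sum>k<n. D n k * v k p)"
    using D_sum[OF assms] by (simp add: right_diff_distrib sum_subtractf)
  have f: "2 * (1 - x) - 3 * (1 - x)\<^sup>2 + (1 - x) ^ 3 = - fAC x" for x :: real
    by (simp add: fAC_def algebra_simps power2_eq_square power3_eq_cube)
  show ?thesis unfolding defect_def rhs_def nbsum_diff s f by (simp add: algebra_simps)
qed

lemma lhs_shift:
  "A n n * (1 - x p) + (1 - \<alpha>/2) * (2 * (1 - x p) - 3 * (1 - x p)\<^sup>2 + (1 - x p) ^ 3)
     + (1 - \<alpha>/2) * c * (4 * (1 - x p) - nbsum M (\<lambda>q. 1 - x q) p) = A n n - lhs n x p"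
  by (simp add: lhs_def nbsum_diff algebra_simps power2_eq_square power3_eq_cube)

lemma nbsum_nonneg:
  assumes "p \<in> grid M" "\<And>q. q \<in> grid M \<Longrightarrow> 0 \<le> u q"
  shows "0 \<le> nbsum M u p"
  using nbsum_mono[of p M "\<lambda>_. 0" u] assms by (simp add: nbsum_const)

text \<open>On [0, 2] the explicit reaction and the diagonal part of the diffusion cost at most
  \<theta> (2 + 4 c) u^{n-1}, which the step conditions bound by \<theta>/(1 - \<theta>) a_0
  u^{n-1}. The neighbours enter with a favourable sign and are kept.\<close>

lemma defect_lower:
  assumes n: "1 \<le> n" "n \<le> N" and p: "p \<in> grid M"
    and u: "\<And>q. q \<in> grid M \<Longrightarrow> 0 \<le> u (n - 1) q \<and> u (n - 1) q \<le> 2"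
  shows "(\<Sum>k<n - 1. D n k * u k p) + (D n (n - 1) - (\<alpha>/2) / (1 - \<alpha>/2) * aL2 \<alpha> t n n) * u (n - 1) p
      + (\<alpha>/2) * c * nbsum M (u (n - 1)) p \<le> defect n u p"
proof -
  define w where "w = u (n - 1) p"
  have w: "0 \<le> w" "w \<le> 2" using u p by (auto simp: w_def)
  have "(\<alpha>/2) * (2 * w - 3 * w\<^sup>2 + w ^ 3) \<le> (\<alpha>/2) * (2 * w)"
    using alpha cubic_upper[OF w] by (intro mult_left_mono) auto
  moreover have "(\<alpha>/2) * (2 + 4 * c) * w \<le> (\<alpha>/2) / (1 - \<alpha>/2) * aL2 \<alpha> t n n * w"
    using step_bounds(2)[OF n] w by (intro mult_right_mono) auto
  moreover have "(\<Sum>k<n. D n k * u k p) = (\<Sum>k<n - 1. D n k * u k p) + D n (n - 1) * w"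
    using n sum.lessThan_Suc[of "\<lambda>k. D n k * u k p" "n - 1"] by (simp add: w_def)
  ultimately show ?thesis unfolding defect_def w_def[symmetric] by (simp add: algebra_simps)
qed

text \<open>If the weight of \<open>u (n - 1)\<close> in step \<open>n\<close> is negative, the equation of step \<open>n - 1\<close> is used to
  dominate \<open>u (n - 1)\<close> by older values and by the values at neighbouring grid points.\<close>

lemma defect_nonneg:
  assumes n: "1 \<le> n" "n \<le> N" and p: "p \<in> grid M"
    and u: "\<And>k q. k < n \<Longrightarrow> q \<in> grid M \<Longrightarrow> 0 \<le> u k q \<and> u k q \<le> 2"
    and prev: "\<And>q. 2 \<le> n \<Longrightarrow> q \<in> grid M \<Longrightarrow>
      A (n - 1) (n - 1) * u (n - 1) q
        + (1 - \<alpha>/2) * (2 * u (n - 1) q - 3 * (u (n - 1) q)\<^sup>2 + u (n - 1) q ^ 3)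
        + (1 - \<alpha>/2) * c * (4 * u (n - 1) q - nbsum M (u (n - 1)) q) = defect (n - 1) u q"
  shows "0 \<le> defect n u p"
proof -
  define \<theta> where "\<theta> = \<alpha>/2"
  have \<theta>: "0 < \<theta>" "\<theta> < 1/2" using alpha by (auto simp: \<theta>_def)
  have sum_nn: "0 \<le> (\<Sum>k<n - 1. D n k * u k p)"
    using D_nonneg[of _ n] u p n by (intro sum_nonneg mult_nonneg_nonneg) auto
  have nb_nn: "0 \<le> nbsum M (u k) q" if "k < n" "q \<in> grid M" for k q
    using u that by (intro nbsum_nonneg) auto
  have un: "0 \<le> u (n - 1) p" using u[of "n - 1" p] p n by simp
  note low = defect_lower[OF n p, of u]
  show ?thesis
  proof (cases "\<theta> / (1 - \<theta>) * aL2 \<alpha> t n n \<le> D n (n - 1)")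
    case True
    have "0 \<le> (D n (n - 1) - \<theta> / (1 - \<theta>) * aL2 \<alpha> t n n) * u (n - 1) p"
      using True un by simp
    moreover have "0 \<le> \<theta> * c * nbsum M (u (n - 1)) p"
      using \<theta> c_nonneg nb_nn[of "n - 1" p] n p by simp
    ultimately show ?thesis using low u n sum_nn unfolding \<theta>_def[symmetric] by simp
  next
    case False
    \<comment> \<open>For n = 1 the only weight is a_0 itself, and \<theta>/(1 - \<theta>) <
      1.\<close>
    have n2: "2 \<le> n"
    proof (rule ccontr)
      assume "\<not> 2 \<le> n"
      then have n1: "n = 1" using n by simp
      have "\<theta> / (1 - \<theta>) * aL2 \<alpha> t 1 1 \<le> 1 * aL2 \<alpha> t 1 1"
        using \<theta> aL2_last_pos[of 1] n n1 by (intro mult_right_mono) auto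
      then show False using False D_one n1 by simp
    qed
    define m where "m = n - 1"
    define b where "b = aL2 \<alpha> t m m"
    define B where "B = A m m"
    obtain \<gamma> where \<gamma>: "0 \<le> \<gamma>" "2 \<le> m"
      and d: "\<theta> / (1 - \<theta>) * aL2 \<alpha> t n n - D n m = \<gamma> * (B - b / 16)"
      and cmp: "\<And>k. k + 2 \<le> m \<Longrightarrow> \<gamma> * D m k \<le> D n k"
      and cmp': "\<gamma> * (D m (m - 1) + b / 16) \<le> D n (m - 1)"
      and \<gamma>\<theta>: "\<gamma> * (1 - \<theta>) \<le> \<theta>"
      and nbc: "\<gamma> * \<theta> * (B + b) \<le> (D m (m - 1) - \<theta> / (1 - \<theta>) * b) * (\<theta> - \<gamma> * (1 - \<theta>))"
      using deficient_weight[OF n2 n(2)] False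
      unfolding \<theta>_def[symmetric] m_def[symmetric] b_def[symmetric] B_def[symmetric] by force
    have mN: "1 \<le> m" "m \<le> N" "m < n" "m - 1 < n" using \<gamma>(2) n by (auto simp: m_def)
    have b: "0 < b" unfolding b_def using aL2_last_pos mN by simp
    have B: "b \<le> B" unfolding b_def B_def using A_last_ge mN by simp
    note sb = step_bounds[OF mN(1,2), folded \<theta>_def b_def]
    note eq = prev[OF n2, folded m_def \<theta>_def, folded B_def]
    have um: "0 \<le> u m q" "u m q \<le> 2" "0 \<le> u (m - 1) q" "u (m - 1) q \<le> 2" if "q \<in> grid M" for q
      using u[of m q] u[of "m - 1" q] that mN by auto
    \<comment> \<open>Discarding favourable terms in the equation of step m leaves W u^{m-1} <= (B +
      b) u^m; the last condition on \<gamma> turns this into the claim.\<close>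
    have point: "\<gamma> * \<theta> * u (m - 1) q + \<gamma> * (1 - \<theta>) * u m q \<le> \<theta> * u m q" if q: "q \<in> grid M" for q
    proof -
      define W where "W = D m (m - 1) - \<theta> / (1 - \<theta>) * b"
      have "0 \<le> (\<Sum>k<m - 1. D m k * u k q)"
        using D_nonneg[of _ m] u q mN by (intro sum_nonneg mult_nonneg_nonneg) auto
      moreover have "0 \<le> \<theta> * c * nbsum M (u (m - 1)) q"
        using \<theta> c_nonneg nb_nn[of "m - 1" q] mN q by simp
      moreover have "(\<Sum>k<m - 1. D m k * u k q) + W * u (m - 1) q
          + \<theta> * c * nbsum M (u (m - 1)) q \<le> defect m u q"
        using defect_lower[OF mN(1,2) q, of u] um unfolding W_def \<theta>_def b_def by simp
      ultimately have "W * u (m - 1) q \<le> defect m u q" by linarith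
      also have "\<dots> = B * u m q + (1 - \<theta>) * (2 * u m q - 3 * (u m q)\<^sup>2 + u m q ^ 3)
         + (1 - \<theta>) * c * (4 * u m q - nbsum M (u m) q)" using eq[OF q] by simp
      also have "\<dots> \<le> (B + b) * u m q"
      proof -
        have "(1 - \<theta>) * (2 * u m q - 3 * (u m q)\<^sup>2 + u m q ^ 3) \<le> (1 - \<theta>) * (2 * u m q)"
          using \<theta> cubic_upper[OF um(1,2)[OF q]] by (intro mult_left_mono) auto
        moreover have "(1 - \<theta>) * c * (4 * u m q - nbsum M (u m) q) \<le> (1 - \<theta>) * c * (4 * u m q)"
          using \<theta> c_nonneg nb_nn[of m q] mN q by (intro mult_left_mono) auto
        moreover have "(1 - \<theta>) * (2 + 4 * c) * u m q \<le> b * u m q"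
          using sb(1) um(1)[OF q] by (intro mult_right_mono) auto
        ultimately show ?thesis by (simp add: algebra_simps)
      qed
      finally have W: "W * u (m - 1) q \<le> (B + b) * u m q" .
      have "(B + b) * (\<gamma> * \<theta> * u (m - 1) q) = \<gamma> * \<theta> * (B + b) * u (m - 1) q" by simp
      also have "\<dots> \<le> W * (\<theta> - \<gamma> * (1 - \<theta>)) * u (m - 1) q"
        using nbc um(3)[OF q] unfolding W_def by (intro mult_right_mono) auto
      also have "\<dots> = (\<theta> - \<gamma> * (1 - \<theta>)) * (W * u (m - 1) q)" by simp
      also have "\<dots> \<le> (\<theta> - \<gamma> * (1 - \<theta>)) * ((B + b) * u m q)"
        using W \<gamma>\<theta> by (intro mult_left_mono) auto
      also have "\<dots> = (B + b) * ((\<theta> - \<gamma> * (1 - \<theta>)) * u m q)" by simp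
      finally have "\<gamma> * \<theta> * u (m - 1) q \<le> (\<theta> - \<gamma> * (1 - \<theta>)) * u m q"
        using b B by (simp add: mult_le_cancel_left_pos)
      then show ?thesis by (simp add: algebra_simps)
    qed
    \<comment> \<open>Summed over neighbours: the one neighbour term offered by step n pays for both
      that \<gamma> times step m introduces.\<close>
    have nb: "\<gamma> * \<theta> * nbsum M (u (m - 1)) p + \<gamma> * (1 - \<theta>) * nbsum M (u m) p \<le> \<theta> * nbsum M (u m) p"
    proof -
      have "nbsum M (\<lambda>q. \<gamma> * \<theta> * u (m - 1) q + \<gamma> * (1 - \<theta>) * u m q) p \<le> nbsum M (\<lambda>q. \<theta> * u m q) p"
        by (rule nbsum_mono[OF p point])
      then show ?thesis using nbsum_linear[of M "\<gamma> * \<theta>" "u (m - 1)" "\<gamma> * (1 - \<theta>)" "u m" p]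
        nbsum_linear[of M \<theta> "u m" 0 "u m" p] by simp
    qed
    define S where "S = (\<Sum>k<m - 1. D m k * u k p)"
    have "(B - b / 16) * u m p \<le> S + (D m (m - 1) + b / 16) * u (m - 1) p
        + \<theta> * c * nbsum M (u (m - 1)) p + (1 - \<theta>) * c * nbsum M (u m) p"
    proof -
      define x where "x = u m p"
      define x' where "x' = u (m - 1) p"
      have x: "0 \<le> x" "0 \<le> x'" using um[OF p] by (auto simp: x_def x'_def)
      have "(\<Sum>k<m. D m k * u k p) = S + D m (m - 1) * x'"
        using \<gamma>(2) sum.lessThan_Suc[of "\<lambda>k. D m k * u k p" "m - 1"] by (simp add: S_def x'_def)
      then have e: "B * x + (1 - \<theta>) * (2 * x - 3 * x\<^sup>2 + x ^ 3) + (1 - \<theta>) * c * (4 * x - nbsum M (u m) p)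
         = S + D m (m - 1) * x' - \<theta> * (2 * x' - 3 * x'\<^sup>2 + x' ^ 3) - \<theta> * c * (4 * x' - nbsum M (u (m - 1)) p)"
        using eq[OF p] unfolding defect_def \<theta>_def[symmetric] x_def[symmetric] x'_def[symmetric] by simp
      \<comment> \<open>Linear bookkeeping: the cubic terms r and r' cost at most b/16 each, the
        diagonal diffusion terms U and U' are dropped, the neighbour terms V and V' are
        kept.\<close>
      have fin: "(B - b / 16) * x \<le> S + (D' + b / 16) * x' + V' + V"
        if "B * x + r + (U - V) = S + D' * x' - r' - (U' - V')"
          "- (f * x) \<le> r" "f * x \<le> b / 16 * x" "- (f' * x') \<le> r'" "f' * x' \<le> b / 16 * x'"
          "0 \<le> U" "0 \<le> U'" for r r' U U' V V' D' f f' :: real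
        using that unfolding left_diff_distrib distrib_right by linarith
      have "(1 - \<theta>) * (- (x / 4)) \<le> (1 - \<theta>) * (2 * x - 3 * x\<^sup>2 + x ^ 3)"
        using \<theta> cubic_lower[OF x(1)] by (intro mult_left_mono) auto
      then have l1: "- ((1 - \<theta>) / 4 * x) \<le> (1 - \<theta>) * (2 * x - 3 * x\<^sup>2 + x ^ 3)" by simp
      have "\<theta> * (- (x' / 4)) \<le> \<theta> * (2 * x' - 3 * x'\<^sup>2 + x' ^ 3)"
        using \<theta> cubic_lower[OF x(2)] by (intro mult_left_mono) auto
      then have l2: "- (\<theta> / 4 * x') \<le> \<theta> * (2 * x' - 3 * x'\<^sup>2 + x' ^ 3)" by simp
      show ?thesis unfolding x_def[symmetric] x'_def[symmetric]
      proof (rule fin[OF e[unfolded right_diff_distrib[of "(1 - \<theta>) * c"] right_diff_distrib[of "\<theta> * c"]] l1 _ l2])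
        show "(1 - \<theta>) / 4 * x \<le> b / 16 * x" using sb(3) x by (intro mult_right_mono) auto
        show "\<theta> / 4 * x' \<le> b / 16 * x'" using sb(4) x by (intro mult_right_mono) auto
      qed (use \<theta> c_nonneg x in auto)
    qed
    from mult_left_mono[OF this \<gamma>(1)]
    have "\<gamma> * (B - b / 16) * u m p \<le> \<gamma> * S + \<gamma> * (D m (m - 1) + b / 16) * u (m - 1) p
        + c * (\<gamma> * \<theta> * nbsum M (u (m - 1)) p + \<gamma> * (1 - \<theta>) * nbsum M (u m) p)"
      by (simp add: algebra_simps)
    also have "\<dots> \<le> (\<Sum>k<m - 1. D n k * u k p) + D n (m - 1) * u (m - 1) p + c * (\<theta> * nbsum M (u m) p)"
    proof (intro add_mono)
      have "\<gamma> * S = (\<Sum>k<m - 1. \<gamma> * D m k * u k p)" by (simp add: S_def sum_distrib_left mult.assoc)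
      also have "\<dots> \<le> (\<Sum>k<m - 1. D n k * u k p)"
        using cmp u p mN by (intro sum_mono mult_right_mono) auto
      finally show "\<gamma> * S \<le> (\<Sum>k<m - 1. D n k * u k p)" .
      show "\<gamma> * (D m (m - 1) + b / 16) * u (m - 1) p \<le> D n (m - 1) * u (m - 1) p"
        using cmp' um(3)[OF p] by (intro mult_right_mono) auto
    qed (use nb c_nonneg in \<open>intro mult_left_mono, auto\<close>)
    also have "(\<Sum>k<m - 1. D n k * u k p) + D n (m - 1) * u (m - 1) p = (\<Sum>k<m. D n k * u k p)"
      using \<gamma>(2) sum.lessThan_Suc[of "\<lambda>k. D n k * u k p" "m - 1"] by simp
    finally have le: "\<gamma> * (B - b / 16) * u m p \<le> (\<Sum>k<m. D n k * u k p) + c * (\<theta> * nbsum M (u m) p)" .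
    have neg: "D n m - \<theta> / (1 - \<theta>) * aL2 \<alpha> t n n = - (\<gamma> * (B - b / 16))" using d by linarith
    have "0 \<le> (\<Sum>k<m. D n k * u k p) + (D n m - \<theta> / (1 - \<theta>) * aL2 \<alpha> t n n) * u m p
       + \<theta> * c * nbsum M (u m) p"
      unfolding neg mult_minus_left mult.assoc[of \<theta> c] mult.left_commute[of \<theta> c] using le by linarith
    also have "\<dots> \<le> defect n u p" using low u mN unfolding m_def \<theta>_def by simp
    finally show ?thesis .
  qed
qed

lemma rhs_le:
  assumes n: "1 \<le> n" "n \<le> N" and p: "p \<in> grid M"
    and v: "\<And>k q. k < n \<Longrightarrow> q \<in> grid M \<Longrightarrow> \<bar>v k q\<bar> \<le> 1"
    and prev: "\<And>q. 2 \<le> n \<Longrightarrow> q \<in> grid M \<Longrightarrow> lhs (n - 1) (v (n - 1)) q = rhs (n - 1) v q"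
  shows "rhs n v p \<le> A n n"
proof -
  have "0 \<le> defect n (\<lambda>k q. 1 - v k q) p"
  proof (rule defect_nonneg[OF n p])
    show "0 \<le> 1 - v k q \<and> 1 - v k q \<le> 2" if "k < n" "q \<in> grid M" for k q
      using v[OF that] by (simp add: abs_le_iff)
  next
    fix q assume "2 \<le> n" "q \<in> grid M"
    then show "A (n - 1) (n - 1) * (1 - v (n - 1) q)
        + (1 - \<alpha>/2) * (2 * (1 - v (n - 1) q) - 3 * (1 - v (n - 1) q)\<^sup>2 + (1 - v (n - 1) q) ^ 3)
        + (1 - \<alpha>/2) * c * (4 * (1 - v (n - 1) q) - nbsum M (\<lambda>q. 1 - v (n - 1) q) q)
      = defect (n - 1) (\<lambda>k q. 1 - v k q) q"
      using prev[of q] n unfolding lhs_shift by (subst defect_rhs) auto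
  qed
  then show ?thesis unfolding defect_rhs[OF n] by simp
qed

text \<open>Since f is odd, the barrier -1 follows from the barrier 1 applied to the negated
  solution.\<close>

lemma rhs_uminus: "rhs n (\<lambda>k q. - v k q) p = - rhs n v p"
  by (simp add: rhs_def fAC_def nbsum_def sum_negf algebra_simps)

lemma lhs_uminus: "lhs n (\<lambda>q. - x q) p = - lhs n x p"
  by (simp add: lhs_def nbsum_def algebra_simps)

lemma lhs_const: "lhs n (\<lambda>q. x) p = (A n n - (1 - \<alpha>/2)) * x + (1 - \<alpha>/2) * x ^ 3"
  by (simp add: lhs_def nbsum_const)

section \<open>Solutions over all time levels\<close>

definition solves :: "(nat \<Rightarrow> nat \<times> nat \<Rightarrow> real) \<Rightarrow> (nat \<times> nat \<Rightarrow> real) \<Rightarrow> bool" where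
  "solves v v0 \<longleftrightarrow> (\<forall>p \<in> grid M. v 0 p = v0 p) \<and> (\<forall>n \<in> {1..N}. \<forall>p \<in> grid M. lhs n (v n) p = rhs n v p)"

lemma maximum_bound:
  assumes v: "solves v v0" and v0: "\<And>p. p \<in> grid M \<Longrightarrow> \<bar>v0 p\<bar> \<le> 1"
  shows "n \<le> N \<Longrightarrow> p \<in> grid M \<Longrightarrow> \<bar>v n p\<bar> \<le> 1"
proof (induction n arbitrary: p rule: less_induct)
  case (less n)
  show ?case
  proof (cases "n = 0")
    case True
    then show ?thesis using v v0 less.prems by (simp add: solves_def)
  next
    case False
    then have n: "1 \<le> n" "n \<le> N" using less.prems by auto
    have IH: "\<bar>v k q\<bar> \<le> 1" if "k < n" "q \<in> grid M" for k q using less.IH[of k q] that n by simp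
    have eq: "lhs m (v m) q = rhs m v q" if "1 \<le> m" "m \<le> N" "q \<in> grid M" for m q
      using v that by (simp add: solves_def)
    have up: "rhs n v q \<le> A n n" if "q \<in> grid M" for q
      using IH eq n that by (intro rhs_le) auto
    have nlo: "rhs n (\<lambda>k q. - v k q) q \<le> A n n" if q: "q \<in> grid M" for q
    proof (rule rhs_le[OF n q])
      show "lhs (n - 1) (\<lambda>q. - v (n - 1) q) r = rhs (n - 1) (\<lambda>k q. - v k q) r" if "2 \<le> n" "r \<in> grid M" for r
        using eq[of "n - 1" r] that n by (simp add: lhs_uminus rhs_uminus)
    qed (use IH in simp)
    have lo: "- A n n \<le> rhs n v q" if "q \<in> grid M" for q
      using nlo[OF that] unfolding rhs_uminus by linarith
    \<comment> \<open>f vanishes at 1 and -1, so \<open>lhs n\<close> takes exactly the values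
      \<open>A n n\<close> and \<open>- A n n\<close> at these constants.\<close>
    have "v n p \<le> 1"
      by (rule lhs_mono[OF n, of "v n" "\<lambda>_. 1"]) (use up eq n less.prems in \<open>auto simp: lhs_const\<close>)
    moreover have "- 1 \<le> v n p"
      by (rule lhs_mono[OF n, of "\<lambda>_. - 1" "v n"]) (use lo eq n less.prems in \<open>auto simp: lhs_const\<close>)
    ultimately show ?thesis by (simp add: abs_le_iff)
  qed
qed

lemma solution_exists: "\<exists>v. solves v v0"
proof -
  \<comment> \<open>Each step depends on all earlier levels, hence a choice along a well-founded
    relation; levels beyond N are left unconstrained.\<close>
  define P where "P f n x \<longleftrightarrow> (if n = 0 then x = v0 else n \<le> N \<longrightarrow> (\<forall>p \<in> grid M. lhs n x p = rhs n f p))" for f n x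
  have "\<exists>v. \<forall>n. P v n (v n)"
  proof (rule dependent_wf_choice[OF wf_less_than])
    fix f g :: "nat \<Rightarrow> nat \<times> nat \<Rightarrow> real" and n x
    assume "\<And>z. (z, n) \<in> less_than \<Longrightarrow> f z = g z"
    then show "P f n x = P g n x" unfolding P_def using rhs_cong[of n _ f g] by auto
  next
    fix n f
    show "\<exists>x. P f n x" unfolding P_def using lhs_surj[of n "rhs n f"] by (cases "n = 0"; cases "n \<le> N") auto
  qed
  then obtain v where v: "\<And>n. P v n (v n)" by blast
  have "solves v v0" unfolding solves_def using v[of 0] v unfolding P_def by auto
  then show ?thesis by blast
qed

lemma solution_unique:
  assumes v: "solves v v0" and w: "solves w v0"
  shows "n \<le> N \<Longrightarrow> p \<in> grid M \<Longrightarrow> v n p = w n p"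
proof (induction n arbitrary: p rule: less_induct)
  case (less n)
  show ?case
  proof (cases "n = 0")
    case True
    then show ?thesis using v w less.prems by (simp add: solves_def)
  next
    case False
    then have n: "1 \<le> n" "n \<le> N" using less.prems by auto
    have "lhs n (v n) q = lhs n (w n) q" if "q \<in> grid M" for q
      using rhs_cong[OF n(1) that, of v w] less.IH v w that n by (simp add: solves_def)
    then show ?thesis
      using lhs_mono[OF n, of "v n" "w n" p] lhs_mono[OF n, of "w n" "v n" p] less.prems by force
  qed
qed

end

section \<open>Return to the original form of the scheme\<close>

lemma scheme_sol_iff:
  assumes "allen_cahn_mesh \<alpha> t N (\<epsilon>\<^sup>2 / h\<^sup>2)"
  shows "scheme_sol \<alpha> \<epsilon> h M t N phi0 Phi \<longleftrightarrow> allen_cahn_mesh.solves \<alpha> t N M (\<epsilon>\<^sup>2 / h\<^sup>2) Phi phi0"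
proof -
  interpret allen_cahn_mesh \<alpha> t N M "\<epsilon>\<^sup>2 / h\<^sup>2" by (rule assms)
  have "(L2sig \<alpha> t n (\<lambda>k. Phi k p) =
          - ((\<alpha>/2) * fAC (Phi (n - 1) p) + (1 - \<alpha>/2) * fAC (Phi n p)
             - \<epsilon>^2 * lap M h (\<lambda>q. (\<alpha>/2) * Phi (n - 1) q + (1 - \<alpha>/2) * Phi n q) p))
     \<longleftrightarrow> lhs n (Phi n) p = rhs n Phi p" if "n \<in> {1..N}" for n p
  proof -
    have n: "1 \<le> n" "n \<le> N" using that by auto
    have e: "\<epsilon>\<^sup>2 * lap M h (\<lambda>q. (\<alpha>/2) * Phi (n - 1) q + (1 - \<alpha>/2) * Phi n q) p
      = \<epsilon>\<^sup>2 / h\<^sup>2 * ((\<alpha>/2) * (nbsum M (Phi (n - 1)) p - 4 * Phi (n - 1) p)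
          + (1 - \<alpha>/2) * (nbsum M (Phi n) p - 4 * Phi n p))"
    proof -
      have aux: "\<epsilon>\<^sup>2 * (X / h\<^sup>2) = \<epsilon>\<^sup>2 / h\<^sup>2 * Y" if "X = Y" for X Y using that by simp
      show ?thesis unfolding lap_nbsum nbsum_linear by (rule aux) (simp add: algebra_simps)
    qed
    define c where "c = \<epsilon>\<^sup>2 / h\<^sup>2"
    show ?thesis
      unfolding L2sig_weights[OF n] e lhs_def rhs_def unfolding c_def[symmetric]
      by (simp add: fAC_def algebra_simps)
  qed
  then show ?thesis unfolding scheme_sol_def solves_def by simp
qed

theorem theorem3p1:
  fixes \<alpha> \<epsilon> L h :: real and M N :: nat and t :: "nat \<Rightarrow> real"
    and phi0 :: "nat \<times> nat \<Rightarrow> real"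
  assumes alpha: "0 < \<alpha>" "\<alpha> < 1"
    and eps: "\<epsilon> > 0"
    and L: "L > 0" and M: "M \<ge> 1" and h: "h = L / real M"
    and t0: "t 0 = 0"
    and tmono: "\<forall>k \<in> {1..N}. t (k - 1) < t k"
    and ratio_cond: "\<forall>k. 2 \<le> k \<and> k \<le> N \<longrightarrow> ratio t k \<ge> r_star \<alpha>"
    and step_cond: "\<forall>n \<in> {1..N}. tau t n \<le>
       min (((\<alpha>/2) * omega (2 - \<alpha>) (1 - \<alpha>/2) / (2 * (1 - \<alpha>/2))) powr (1 / \<alpha>))
           ((h^2 * omega (2 - \<alpha>) (1 - \<alpha>/2) / (4 * \<epsilon>^2)) powr (1 / \<alpha>))"
  shows "\<exists>Phi. scheme_sol \<alpha> \<epsilon> h M t N phi0 Phi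
           \<and> (\<forall>Psi. scheme_sol \<alpha> \<epsilon> h M t N phi0 Psi \<longrightarrow>
                 (\<forall>n \<le> N. \<forall>p \<in> grid M. Psi n p = Phi n p))
           \<and> (maxnorm M phi0 \<le> 1 \<longrightarrow> (\<forall>n \<in> {1..N}. maxnorm M (Phi n) \<le> 1))"
proof -
  interpret sigma_mesh \<alpha> t N
    using alpha tmono ratio_cond r_star_lower[OF alpha] by unfold_locales force+
  define w where "w = omega (2 - \<alpha>) (1 - \<alpha>/2)"
  have w: "0 < w" unfolding w_def omega_def using alpha by (simp add: Gamma_real_pos)
  have h0: "0 < h" unfolding h using L M by simp
  \<comment> \<open>By the closed form of a_0 the bound tau_n <= (w/X)^(1/\<alpha>) yields a_0 >= X;
    it is applied to X = 2 (1 - \<theta>)/\<theta> and X = 4 \<epsilon>^2/h^2.\<close>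
  have step: "X \<le> aL2 \<alpha> t n n" if "n \<in> {1..N}" "0 < X" "tau t n \<le> (w / X) powr (1 / \<alpha>)" for n X
  proof -
    have tp: "0 < tau t n" using tau_pos[of n] that by simp
    have "tau t n powr \<alpha> \<le> ((w / X) powr (1 / \<alpha>)) powr \<alpha>"
      using that tp alpha by (intro powr_mono2) auto
    also have "\<dots> = w / X" using alpha w that by (simp add: powr_powr)
    finally have "X * tau t n powr \<alpha> \<le> w" using that by (simp add: field_simps)
    then have "X \<le> w * tau t n powr (- \<alpha>)" using tp by (simp add: powr_minus field_simps)
    then show ?thesis using omega_last(1)[of n] that by (simp add: w_def)
  qed
  have mesh': "allen_cahn_mesh \<alpha> t N (\<epsilon>\<^sup>2 / h\<^sup>2)"
  proof unfold_locales
    fix n assume n: "n \<in> {1..N}"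
    have sc: "tau t n \<le> ((\<alpha>/2) * w / (2 * (1 - \<alpha>/2))) powr (1 / \<alpha>)"
      "tau t n \<le> (h\<^sup>2 * w / (4 * \<epsilon>\<^sup>2)) powr (1 / \<alpha>)"
      using bspec[OF step_cond n] unfolding min.bounded_iff w_def by blast+
    have e1: "w / (2 * (1 - \<alpha>/2) / (\<alpha>/2)) = (\<alpha>/2) * w / (2 * (1 - \<alpha>/2))"
      by (metis divide_divide_eq_right mult.commute)
    show "2 * (1 - \<alpha>/2) / (\<alpha>/2) \<le> aL2 \<alpha> t n n"
      by (rule step[OF n], use alpha in simp, unfold e1, rule sc(1))
    have e2: "w / (4 * (\<epsilon>\<^sup>2 / h\<^sup>2)) = h\<^sup>2 * w / (4 * \<epsilon>\<^sup>2)" by simp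
    show "4 * (\<epsilon>\<^sup>2 / h\<^sup>2) \<le> aL2 \<alpha> t n n"
      by (rule step[OF n], use eps h0 in simp, unfold e2, rule sc(2))
  qed simp
  interpret allen_cahn_mesh \<alpha> t N M "\<epsilon>\<^sup>2 / h\<^sup>2" by (rule mesh')
  obtain Phi where Phi: "solves Phi phi0" using solution_exists by blast
  have "\<forall>n \<in> {1..N}. maxnorm M (Phi n) \<le> 1" if "maxnorm M phi0 \<le> 1"
    using maximum_bound[OF Phi] that unfolding maxnorm_le_iff[OF M] by simp
  then show ?thesis
    unfolding scheme_sol_iff[OF mesh'] using Phi solution_unique[OF _ Phi] by blast
qed

end
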